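(* Let $\mathcal{H}(\mathbb{C})$ be the ring of holomorphic functions on the complex plane $\mathbb{C}$. If $M$ is a maximal ideal of $\mathcal{H}(\mathbb{C})$ which is not finitely generated, then the localization $\mathcal{H}(\mathbb{C})_M$ of $\mathcal{H}(\mathbb{C})$ at $M$ is an MTL-ring which is not a BL-ring.
   Context: For ideals $I,J$ of a commutative ring $R$, write $I\rightarrow J=\{x\in R : xI\subseteq J\}$. A commutative ring $R$ such that for every $x\in R$ there is $r\in R$ with $x=rx$ (automatic if $R$ has an identity) is called an MTL-ring if $(I\rightarrow J)+(J\rightarrow I)=R$ for all ideals $I,J$ of $R$. It is called a BL-ring if its ideals form a BL-algebra (with meet $\cap$, join $+$, product of ideals, and residuum $\rightarrow$), i.e. if it is an MTL-ring and moreover $I\cap J=I\cdot(I\rightarrow J)$ for all ideals $I,J$ of $R$. *)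

theory Defs
  imports "HOL-Analysis.Analysis" "HOL-Algebra.Algebra"
begin

definition ideal_residuum :: "('a, 'b) ring_scheme \<Rightarrow> 'a set \<Rightarrow> 'a set \<Rightarrow> 'a set"
  where "ideal_residuum R I J = {x \<in> carrier R. x <#\<^bsub>R\<^esub> I \<subseteq> J}"

text \<open>For commutative rings without identity one also requires that every \<open>x\<close> is of the form
  \<open>r \<otimes> x\<close>; for \<^locale>\<open>cring\<close>, which has an identity, this is automatic.\<close>

locale MTL_ring = cring +
  assumes prelinearity:
    "\<lbrakk>ideal I R; ideal J R\<rbrakk> \<Longrightarrow> ideal_residuum R I J <+> ideal_residuum R J I = carrier R"

locale BL_ring = MTL_ring +
  assumes divisibility:
    "\<lbrakk>ideal I R; ideal J R\<rbrakk> \<Longrightarrow> I \<inter> J = ideal_prod R I (ideal_residuum R I J)"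

definition fin_gen_ideal :: "('a, 'b) ring_scheme \<Rightarrow> 'a set \<Rightarrow> bool"
  where "fin_gen_ideal R I \<longleftrightarrow> (\<exists>A \<subseteq> carrier R. finite A \<and> I = Idl\<^bsub>R\<^esub> A)"

definition frac_rel :: "('a, 'b) ring_scheme \<Rightarrow> 'a set \<Rightarrow> (('a \<times> 'a) \<times> ('a \<times> 'a)) set"
  where "frac_rel R S =
    {((r, s), (r', s')). (r, s) \<in> carrier R \<times> S \<and> (r', s') \<in> carrier R \<times> S \<and>
      (\<exists>t\<in>S. t \<otimes>\<^bsub>R\<^esub> (s' \<otimes>\<^bsub>R\<^esub> r \<ominus>\<^bsub>R\<^esub> s \<otimes>\<^bsub>R\<^esub> r') = \<zero>\<^bsub>R\<^esub>)}"

definition fraction :: "('a, 'b) ring_scheme \<Rightarrow> 'a set \<Rightarrow> 'a \<Rightarrow> 'a \<Rightarrow> ('a \<times> 'a) set"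
  where "fraction R S r s = frac_rel R S `` {(r, s)}"

text \<open>The sum and product of two classes are formed as the union, over all representatives, of
  the resulting classes; by \<open>mult_fraction\<close> and \<open>add_fraction\<close> below, this union is one class.\<close>

definition ring_of_fractions :: "('a, 'b) ring_scheme \<Rightarrow> 'a set \<Rightarrow> ('a \<times> 'a) set ring"
  where "ring_of_fractions R S =
    \<lparr> carrier = (carrier R \<times> S) // frac_rel R S,
      monoid.mult = (\<lambda>x y. \<Union>(r, s)\<in>x. \<Union>(r', s')\<in>y. fraction R S (r \<otimes>\<^bsub>R\<^esub> r') (s \<otimes>\<^bsub>R\<^esub> s')),
      monoid.one = fraction R S \<one>\<^bsub>R\<^esub> \<one>\<^bsub>R\<^esub>,
      ring.zero = fraction R S \<zero>\<^bsub>R\<^esub> \<one>\<^bsub>R\<^esub>,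
      ring.add = (\<lambda>x y. \<Union>(r, s)\<in>x. \<Union>(r', s')\<in>y.
        fraction R S (s' \<otimes>\<^bsub>R\<^esub> r \<oplus>\<^bsub>R\<^esub> s \<otimes>\<^bsub>R\<^esub> r') (s \<otimes>\<^bsub>R\<^esub> s')) \<rparr>"

definition localization_at :: "('a, 'b) ring_scheme \<Rightarrow> 'a set \<Rightarrow> ('a \<times> 'a) set ring"
  where "localization_at R P = ring_of_fractions R (carrier R - P)"

locale mult_subset = cring R for R (structure) +
  fixes S
  assumes S_carrier: "S \<subseteq> carrier R"
    and S_one: "\<one> \<in> S"
    and S_mult: "\<lbrakk>s \<in> S; t \<in> S\<rbrakk> \<Longrightarrow> s \<otimes> t \<in> S"
begin

lemma S_in_carrier [simp]: "s \<in> S \<Longrightarrow> s \<in> carrier R"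
  using S_carrier by blast

lemma frac_rel_iff:
  assumes "r \<in> carrier R" "s \<in> S" "r' \<in> carrier R" "s' \<in> S"
  shows "((r, s), (r', s')) \<in> frac_rel R S \<longleftrightarrow> (\<exists>t\<in>S. t \<otimes> (s' \<otimes> r) = t \<otimes> (s \<otimes> r'))"
proof -
  have "t \<otimes> (s' \<otimes> r \<ominus> s \<otimes> r') = \<zero> \<longleftrightarrow> t \<otimes> (s' \<otimes> r) = t \<otimes> (s \<otimes> r')" if "t \<in> S" for t
  proof -
    have "t \<otimes> (s' \<otimes> r \<ominus> s \<otimes> r') = t \<otimes> (s' \<otimes> r) \<ominus> t \<otimes> (s \<otimes> r')"
      using assms that by (simp add: a_minus_def r_distr r_minus)
    thus ?thesis
      using assms that by (simp add: r_right_minus_eq)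
  qed
  thus ?thesis
    using assms by (auto simp: frac_rel_def)
qed

lemma equiv_frac_rel: "equiv (carrier R \<times> S) (frac_rel R S)"
proof (rule equivI)
  show "frac_rel R S \<subseteq> (carrier R \<times> S) \<times> (carrier R \<times> S)"
    by (auto simp: frac_rel_def)
  show "refl_on (carrier R \<times> S) (frac_rel R S)"
    using S_one by (auto simp: refl_on_def frac_rel_iff)
  show "sym (frac_rel R S)"
  proof (rule symI)
    fix x y assume xy: "(x, y) \<in> frac_rel R S"
    obtain r s r' s' where eq: "x = (r, s)" "y = (r', s')"
      by fastforce
    with xy have c: "r \<in> carrier R" "s \<in> S" "r' \<in> carrier R" "s' \<in> S"
      by (auto simp: frac_rel_def)
    show "(y, x) \<in> frac_rel R S"
      using xy c unfolding eq by (auto simp: frac_rel_iff) (metis)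
  qed
  show "trans (frac_rel R S)"
  proof (rule transI)
    fix x y z assume xy: "(x, y) \<in> frac_rel R S" and yz: "(y, z) \<in> frac_rel R S"
    obtain r s r' s' r'' s'' where eq: "x = (r, s)" "y = (r', s')" "z = (r'', s'')"
      by (metis surj_pair)
    with xy yz have c: "r \<in> carrier R" "s \<in> S" "r' \<in> carrier R" "s' \<in> S"
        "r'' \<in> carrier R" "s'' \<in> S"
      by (auto simp: frac_rel_def)
    obtain t where t: "t \<in> S" "t \<otimes> (s' \<otimes> r) = t \<otimes> (s \<otimes> r')"
      using xy c unfolding eq by (auto simp: frac_rel_iff)
    obtain u where u: "u \<in> S" "u \<otimes> (s'' \<otimes> r') = u \<otimes> (s' \<otimes> r'')"
      using yz c unfolding eq by (auto simp: frac_rel_iff)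
    have "(t \<otimes> u \<otimes> s') \<otimes> (s'' \<otimes> r) = (u \<otimes> s'') \<otimes> (t \<otimes> (s' \<otimes> r))"
      using c t(1) u(1) by (simp add: m_ac)
    also have "\<dots> = (t \<otimes> s) \<otimes> (u \<otimes> (s'' \<otimes> r'))"
      unfolding t(2) using c t(1) u(1) by (simp add: m_ac)
    also have "\<dots> = (t \<otimes> u \<otimes> s') \<otimes> (s \<otimes> r'')"
      unfolding u(2) using c t(1) u(1) by (simp add: m_ac)
    finally have "(t \<otimes> u \<otimes> s') \<otimes> (s'' \<otimes> r) = (t \<otimes> u \<otimes> s') \<otimes> (s \<otimes> r'')" .
    moreover have "t \<otimes> u \<otimes> s' \<in> S"
      using c t(1) u(1) S_mult by blast
    ultimately show "(x, z) \<in> frac_rel R S"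
      using c unfolding eq by (auto simp: frac_rel_iff)
  qed
qed

lemma fraction_eq_iff:
  assumes "r \<in> carrier R" "s \<in> S" "r' \<in> carrier R" "s' \<in> S"
  shows "fraction R S r s = fraction R S r' s' \<longleftrightarrow> (\<exists>t\<in>S. t \<otimes> (s' \<otimes> r) = t \<otimes> (s \<otimes> r'))"
  unfolding fraction_def
  using eq_equiv_class_iff[OF equiv_frac_rel, of "(r, s)" "(r', s')"] assms
  by (simp add: frac_rel_iff)

lemma fraction_eqI:
  assumes "r \<in> carrier R" "s \<in> S" "r' \<in> carrier R" "s' \<in> S" "s' \<otimes> r = s \<otimes> r'"
  shows "fraction R S r s = fraction R S r' s'"
  using assms S_one by (auto simp: fraction_eq_iff)

lemma mem_fraction:
  assumes "(r', s') \<in> fraction R S r s" "r \<in> carrier R" "s \<in> S"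
  shows "r' \<in> carrier R" "s' \<in> S" "\<exists>t\<in>S. t \<otimes> (s' \<otimes> r) = t \<otimes> (s \<otimes> r')"
proof -
  from assms have "((r, s), (r', s')) \<in> frac_rel R S"
    by (simp add: fraction_def)
  moreover from this show "r' \<in> carrier R" "s' \<in> S"
    by (auto simp: frac_rel_def)
  ultimately show "\<exists>t\<in>S. t \<otimes> (s' \<otimes> r) = t \<otimes> (s \<otimes> r')"
    using assms by (simp add: frac_rel_iff)
qed

lemma fraction_self: "\<lbrakk>r \<in> carrier R; s \<in> S\<rbrakk> \<Longrightarrow> (r, s) \<in> fraction R S r s"
  using equiv_class_self[OF equiv_frac_rel, of "(r, s)"] by (simp add: fraction_def)

lemma carrier_fractions:
  "carrier (ring_of_fractions R S) = {fraction R S r s | r s. r \<in> carrier R \<and> s \<in> S}"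
  by (auto simp: ring_of_fractions_def fraction_def quotient_def)

lemma mult_fraction:
  assumes "r \<in> carrier R" "s \<in> S" "r' \<in> carrier R" "s' \<in> S"
  shows "fraction R S r s \<otimes>\<^bsub>ring_of_fractions R S\<^esub> fraction R S r' s' =
    fraction R S (r \<otimes> r') (s \<otimes> s')"
proof -
  have "fraction R S (a \<otimes> a') (b \<otimes> b') = fraction R S (r \<otimes> r') (s \<otimes> s')"
    if ab: "(a, b) \<in> fraction R S r s" "(a', b') \<in> fraction R S r' s'" for a b a' b'
  proof -
    note c = mem_fraction(1,2)[OF ab(1) assms(1,2)] mem_fraction(1,2)[OF ab(2) assms(3,4)] assms
    obtain t where t: "t \<in> S" "t \<otimes> (b \<otimes> r) = t \<otimes> (s \<otimes> a)"
      using mem_fraction(3)[OF ab(1) assms(1,2)] by blast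
    obtain u where u: "u \<in> S" "u \<otimes> (b' \<otimes> r') = u \<otimes> (s' \<otimes> a')"
      using mem_fraction(3)[OF ab(2) assms(3,4)] by blast
    have "(t \<otimes> u) \<otimes> ((b \<otimes> b') \<otimes> (r \<otimes> r')) = (t \<otimes> (b \<otimes> r)) \<otimes> (u \<otimes> (b' \<otimes> r'))"
      using c t(1) u(1) by (simp add: m_ac)
    also have "\<dots> = (t \<otimes> u) \<otimes> ((s \<otimes> s') \<otimes> (a \<otimes> a'))"
      unfolding t(2) u(2) using c t(1) u(1) by (simp add: m_ac)
    finally have "\<exists>v\<in>S. v \<otimes> ((s \<otimes> s') \<otimes> (a \<otimes> a')) = v \<otimes> ((b \<otimes> b') \<otimes> (r \<otimes> r'))"
      using S_mult[OF t(1) u(1)] by metis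
    thus ?thesis
      using c S_mult by (subst fraction_eq_iff) auto
  qed
  hence "\<And>p q. \<lbrakk>p \<in> fraction R S r s; q \<in> fraction R S r' s'\<rbrakk> \<Longrightarrow>
    fraction R S (fst p \<otimes> fst q) (snd p \<otimes> snd q) = fraction R S (r \<otimes> r') (s \<otimes> s')"
    by simp
  moreover have "fraction R S r s \<noteq> {}" "fraction R S r' s' \<noteq> {}"
    using fraction_self assms by blast+
  ultimately show ?thesis
    by (simp add: ring_of_fractions_def case_prod_beta)
qed

lemma add_fraction:
  assumes "r \<in> carrier R" "s \<in> S" "r' \<in> carrier R" "s' \<in> S"
  shows "fraction R S r s \<oplus>\<^bsub>ring_of_fractions R S\<^esub> fraction R S r' s' =
    fraction R S (s' \<otimes> r \<oplus> s \<otimes> r') (s \<otimes> s')"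
proof -
  have "fraction R S (b' \<otimes> a \<oplus> b \<otimes> a') (b \<otimes> b') = fraction R S (s' \<otimes> r \<oplus> s \<otimes> r') (s \<otimes> s')"
    if ab: "(a, b) \<in> fraction R S r s" "(a', b') \<in> fraction R S r' s'" for a b a' b'
  proof -
    note c = mem_fraction(1,2)[OF ab(1) assms(1,2)] mem_fraction(1,2)[OF ab(2) assms(3,4)] assms
    obtain t where t: "t \<in> S" "t \<otimes> (b \<otimes> r) = t \<otimes> (s \<otimes> a)"
      using mem_fraction(3)[OF ab(1) assms(1,2)] by blast
    obtain u where u: "u \<in> S" "u \<otimes> (b' \<otimes> r') = u \<otimes> (s' \<otimes> a')"
      using mem_fraction(3)[OF ab(2) assms(3,4)] by blast
    have "(t \<otimes> u) \<otimes> ((b \<otimes> b') \<otimes> (s' \<otimes> r \<oplus> s \<otimes> r')) =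
        (u \<otimes> b' \<otimes> s') \<otimes> (t \<otimes> (b \<otimes> r)) \<oplus> (t \<otimes> b \<otimes> s) \<otimes> (u \<otimes> (b' \<otimes> r'))"
      using c t(1) u(1) by (simp add: m_ac r_distr)
    also have "\<dots> = (t \<otimes> u) \<otimes> ((s \<otimes> s') \<otimes> (b' \<otimes> a \<oplus> b \<otimes> a'))"
      unfolding t(2) u(2) using c t(1) u(1) by (simp add: m_ac r_distr)
    finally have "\<exists>v\<in>S. v \<otimes> ((s \<otimes> s') \<otimes> (b' \<otimes> a \<oplus> b \<otimes> a')) =
        v \<otimes> ((b \<otimes> b') \<otimes> (s' \<otimes> r \<oplus> s \<otimes> r'))"
      using S_mult[OF t(1) u(1)] by metis
    thus ?thesis
      using c S_mult by (subst fraction_eq_iff) auto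
  qed
  hence "\<And>p q. \<lbrakk>p \<in> fraction R S r s; q \<in> fraction R S r' s'\<rbrakk> \<Longrightarrow>
    fraction R S (snd q \<otimes> fst p \<oplus> snd p \<otimes> fst q) (snd p \<otimes> snd q) =
    fraction R S (s' \<otimes> r \<oplus> s \<otimes> r') (s \<otimes> s')"
    by simp
  moreover have "fraction R S r s \<noteq> {}" "fraction R S r' s' \<noteq> {}"
    using fraction_self assms by blast+
  ultimately show ?thesis
    by (simp add: ring_of_fractions_def case_prod_beta)
qed

lemma one_fraction: "\<one>\<^bsub>ring_of_fractions R S\<^esub> = fraction R S \<one> \<one>"
  and zero_fraction: "\<zero>\<^bsub>ring_of_fractions R S\<^esub> = fraction R S \<zero> \<one>"
  by (simp_all add: ring_of_fractions_def)

lemma cring_fractions: "cring (ring_of_fractions R S)"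
proof -
  let ?L = "ring_of_fractions R S"
  have car: "\<exists>r s. x = fraction R S r s \<and> r \<in> carrier R \<and> s \<in> S" if "x \<in> carrier ?L" for x
    using that by (auto simp: carrier_fractions)
  have in_car: "fraction R S r s \<in> carrier ?L" if "r \<in> carrier R" "s \<in> S" for r s
    using that by (auto simp: carrier_fractions)
  note ops = add_fraction mult_fraction one_fraction zero_fraction S_one S_mult in_car
  show ?thesis
  proof (intro cringI abelian_groupI comm_monoidI)
    fix x y assume "x \<in> carrier ?L" "y \<in> carrier ?L"
    then obtain a b c d where eq: "x = fraction R S a b" "y = fraction R S c d"
      and *: "a \<in> carrier R" "b \<in> S" "c \<in> carrier R" "d \<in> S"
      using car by metis
    show "x \<oplus>\<^bsub>?L\<^esub> y \<in> carrier ?L" "x \<otimes>\<^bsub>?L\<^esub> y \<in> carrier ?L"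
      using * by (simp_all add: eq ops)
    show "x \<oplus>\<^bsub>?L\<^esub> y = y \<oplus>\<^bsub>?L\<^esub> x" "x \<otimes>\<^bsub>?L\<^esub> y = y \<otimes>\<^bsub>?L\<^esub> x"
      using * by (simp_all add: eq ops m_comm a_comm)
  next
    fix x y z assume "x \<in> carrier ?L" "y \<in> carrier ?L" "z \<in> carrier ?L"
    then obtain a b c d e f where
        eq: "x = fraction R S a b" "y = fraction R S c d" "z = fraction R S e f"
      and *: "a \<in> carrier R" "b \<in> S" "c \<in> carrier R" "d \<in> S" "e \<in> carrier R" "f \<in> S"
      using car by metis
    show "x \<oplus>\<^bsub>?L\<^esub> y \<oplus>\<^bsub>?L\<^esub> z = x \<oplus>\<^bsub>?L\<^esub> (y \<oplus>\<^bsub>?L\<^esub> z)" "x \<otimes>\<^bsub>?L\<^esub> y \<otimes>\<^bsub>?L\<^esub> z = x \<otimes>\<^bsub>?L\<^esub> (y \<otimes>\<^bsub>?L\<^esub> z)"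
      using * by (simp_all add: eq ops r_distr l_distr m_ac a_ac)
    show "(x \<oplus>\<^bsub>?L\<^esub> y) \<otimes>\<^bsub>?L\<^esub> z = x \<otimes>\<^bsub>?L\<^esub> z \<oplus>\<^bsub>?L\<^esub> y \<otimes>\<^bsub>?L\<^esub> z"
      using * by (simp add: eq ops, intro fraction_eqI) (simp_all add: ops r_distr l_distr m_ac a_ac)
  next
    fix x assume "x \<in> carrier ?L"
    then obtain a b where eq: "x = fraction R S a b" and *: "a \<in> carrier R" "b \<in> S"
      using car by metis
    show "\<zero>\<^bsub>?L\<^esub> \<oplus>\<^bsub>?L\<^esub> x = x" "\<one>\<^bsub>?L\<^esub> \<otimes>\<^bsub>?L\<^esub> x = x"
      using * by (simp_all add: eq ops)
    have "fraction R S (\<ominus> a) b \<oplus>\<^bsub>?L\<^esub> x = \<zero>\<^bsub>?L\<^esub>"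
      using * by (simp add: eq ops, intro fraction_eqI) (simp_all add: ops r_minus l_neg)
    thus "\<exists>y\<in>carrier ?L. y \<oplus>\<^bsub>?L\<^esub> x = \<zero>\<^bsub>?L\<^esub>"
      using * in_car by (meson a_inv_closed)
  qed (use ops in simp_all)
qed

end

lemma mult_subset_compl_primeideal:
  fixes R (structure)
  assumes "primeideal P R"
  shows "mult_subset R (carrier R - P)"
proof -
  interpret primeideal P R by fact
  have "\<one> \<notin> P"
    using I_notcarr one_imp_carrier by blast
  moreover have "s \<otimes> t \<notin> P" if "s \<in> carrier R - P" "t \<in> carrier R - P" for s t
    using that I_prime by blast
  ultimately show ?thesis
    by unfold_locales auto
qed

definition entire_ring :: "(complex \<Rightarrow> complex) ring"
  where "entire_ring =
    \<lparr> carrier = {f. f holomorphic_on UNIV},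
      monoid.mult = (\<lambda>f g z. f z * g z),
      monoid.one = (\<lambda>_. 1),
      ring.zero = (\<lambda>_. 0),
      ring.add = (\<lambda>f g z. f z + g z) \<rparr>"

lemma cring_entire_ring: "cring entire_ring"
proof (intro cringI abelian_groupI comm_monoidI)
  fix f assume "f \<in> carrier entire_ring"
  hence "(\<lambda>z. - f z) \<in> carrier entire_ring"
    by (auto simp: entire_ring_def intro: holomorphic_intros)
  thus "\<exists>g\<in>carrier entire_ring. g \<oplus>\<^bsub>entire_ring\<^esub> f = \<zero>\<^bsub>entire_ring\<^esub>"
    by (rule bexI[rotated]) (simp add: entire_ring_def)
qed (auto simp: entire_ring_def algebra_simps intro: holomorphic_intros)

lemma cring_localization_entire_ring:
  assumes "maximalideal M entire_ring"
  shows "cring (localization_at entire_ring M)"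
proof -
  have "primeideal M entire_ring"
    using cring.maximalideal_prime[OF cring_entire_ring assms] .
  thus ?thesis
    unfolding localization_at_def
    by (intro mult_subset.cring_fractions mult_subset_compl_primeideal)
qed

end

theory Submission
  imports Defs "HOL-Complex_Analysis.Complex_Analysis"
begin

text \<open>By Weierstrass products two entire functions have a greatest common divisor whose cofactors
  have no common zero, and by interpolation such cofactors generate the unit ideal. Hence for all
  entire \<open>f\<close>, \<open>g\<close> one cofactor lies outside \<open>M\<close>, so the localization at \<open>M\<close> is a valuation ring: its
  ideals form a chain, which gives prelinearity. In a valuation domain the BL identity forces every
  nonzero ideal to be principal. But for a nonzero \<open>b \<in> M\<close> the ideal of all elements divisible by every
  power of \<open>b\<close> is never principal unless it is zero. It is nonzero: as \<open>M\<close> is not finitely generated, it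
  contains no \<open>z - a\<close>, hence no nonzero function with finitely many zeros, and so an entire function
  whose order at each zero \<open>w\<close> of \<open>b\<close> is \<open>\<lfloor>\<bar>w\<bar>\<rfloor>\<close> times that of \<open>b\<close> is divisible by all powers of \<open>b\<close>
  in the localization.\<close>

section \<open>Valuation rings\<close>

context cring
begin

text \<open>Incomparable ideals would supply \<open>x\<close> in \<open>I\<close> only and
  \<open>y\<close> in \<open>J\<close> only; whichever divides the other puts a multiple into the
  wrong ideal.\<close>

lemma divides_total_imp_ideals_total:
  assumes total: "\<And>x y. \<lbrakk>x \<in> carrier R; y \<in> carrier R\<rbrakk> \<Longrightarrow> x divides y \<or> y divides x"
    and "ideal I R" "ideal J R"
  shows "I \<subseteq> J \<or> J \<subseteq> I"
proof (rule ccontr)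
  interpret I: ideal I R by fact
  interpret J: ideal J R by fact
  assume "\<not> (I \<subseteq> J \<or> J \<subseteq> I)"
  then obtain x y where xy: "x \<in> I" "x \<notin> J" "y \<in> J" "y \<notin> I"
    by blast
  with total[of x y] have "x divides y \<or> y divides x"
    by auto
  with xy show False
    by (auto elim!: dividesE simp: I.I_r_closed J.I_r_closed)
qed

text \<open>For comparable ideals the residuum of the smaller into the larger is the whole ring, and
  the other residuum contains zero, so the sum is the whole ring.\<close>

lemma MTL_ring_if_divides_total:
  assumes total: "\<And>x y. \<lbrakk>x \<in> carrier R; y \<in> carrier R\<rbrakk> \<Longrightarrow> x divides y \<or> y divides x"
  shows "MTL_ring R"
proof
  fix I J assume I: "ideal I R" and J: "ideal J R"
  have full: "ideal_residuum R I' J' = carrier R" if "I' \<subseteq> J'" "ideal J' R" for I' J'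
    using that ideal.I_l_closed[OF that(2)] by (auto simp: ideal_residuum_def l_coset_def)
  have zero: "\<zero> \<in> ideal_residuum R I' J'" if "ideal I' R" "ideal J' R" for I' J'
    using that additive_subgroup.zero_closed[OF ideal.axioms(1)[OF that(2)]]
      ideal.Icarr[OF that(1)]
    by (auto simp: ideal_residuum_def l_coset_def)
  have sub: "ideal_residuum R I' J' \<subseteq> carrier R" for I' J'
    by (auto simp: ideal_residuum_def)
  consider "I \<subseteq> J" | "J \<subseteq> I"
    using divides_total_imp_ideals_total[OF total I J] by blast
  then show "ideal_residuum R I J <+> ideal_residuum R J I = carrier R"
  proof cases
    case 1
    show ?thesis
    proof (rule subset_antisym; rule subsetI)
      fix x assume "x \<in> carrier R"
      then show "x \<in> ideal_residuum R I J <+>\<^bsub>R\<^esub> ideal_residuum R J I"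
        using zero[OF J I] r_zero[of x] full[OF 1 J] unfolding set_add_def' by force
    qed (use sub in \<open>force simp: set_add_def'\<close>)
  next
    case 2
    show ?thesis
    proof (rule subset_antisym; rule subsetI)
      fix x assume "x \<in> carrier R"
      then show "x \<in> ideal_residuum R I J <+>\<^bsub>R\<^esub> ideal_residuum R J I"
        using zero[OF I J] l_zero[of x] full[OF 2 I] unfolding set_add_def' by force
    qed (use sub in \<open>force simp: set_add_def'\<close>)
  qed
qed

text \<open>In a sum \<open>a b + c d\<close> one of \<open>a\<close>, \<open>c\<close> divides the
  other and can be factored out, so single products are already closed under addition.\<close>

lemma ideal_prod_eq_products:
  assumes total: "\<And>x y. \<lbrakk>x \<in> carrier R; y \<in> carrier R\<rbrakk> \<Longrightarrow> x divides y \<or> y divides x"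
    and "ideal I R" "ideal J R" "z \<in> ideal_prod R I J"
  shows "\<exists>x\<in>I. \<exists>y\<in>J. z = x \<otimes> y"
proof -
  interpret I: ideal I R by fact
  interpret J: ideal J R by fact
  \<comment> \<open>The case where the second left factor is the multiple \<open>a r\<close> of the
    first.\<close>
  have add: "\<exists>x\<in>I. \<exists>y\<in>J. a \<otimes> b \<oplus> (a \<otimes> r) \<otimes> d = x \<otimes> y"
    if "a \<in> I" "b \<in> J" "r \<in> carrier R" "d \<in> J" for a b r d
  proof (intro bexI)
    show "a \<otimes> b \<oplus> (a \<otimes> r) \<otimes> d = a \<otimes> (b \<oplus> r \<otimes> d)"
      using that by (simp add: r_distr m_assoc)
    show "b \<oplus> r \<otimes> d \<in> J"
      using that by (simp add: J.I_l_closed J.a_closed)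
  qed fact
  show ?thesis
    using assms(4)
  proof induction
    case (sum s1 s2)
    then obtain a b c d where *: "a \<in> I" "b \<in> J" "c \<in> I" "d \<in> J" "s1 = a \<otimes> b" "s2 = c \<otimes> d"
      by blast
    from total[of a c] * have "a divides c \<or> c divides a"
      by auto
    then show ?case
    proof
      assume "a divides c"
      then obtain r where "r \<in> carrier R" "c = a \<otimes> r"
        by (rule dividesE)
      then show ?thesis
        using * add by simp
    next
      assume "c divides a"
      then obtain r where r: "r \<in> carrier R" "a = c \<otimes> r"
        by (rule dividesE)
      have "s1 \<oplus> s2 = s2 \<oplus> s1"
        using * by (simp add: a_comm)
      then show ?thesis
        using * r add by simp
    qed
  qed blast
qed

end

text \<open>Divisibility for \<open>J\<close> and the principal ideal of \<open>f\<close> puts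
  \<open>f\<close> into the product of \<open>J\<close> with the residuum \<open>K\<close>, so
  \<open>f = a x\<close> with \<open>x J\<close> inside the multiples of \<open>f\<close>. For
  \<open>b\<close> in \<open>J\<close> this gives \<open>x b = r f = x a r\<close>, and cancelling
  \<open>x\<close> shows that \<open>a\<close> divides \<open>b\<close>.\<close>

lemma (in BL_ring) nonzero_ideal_principal:
  assumes "domain R"
    and total: "\<And>x y. \<lbrakk>x \<in> carrier R; y \<in> carrier R\<rbrakk> \<Longrightarrow> x divides y \<or> y divides x"
    and J: "ideal J R" and f: "f \<in> J" "f \<noteq> \<zero>"
  obtains a where "a \<in> J" "\<And>b. b \<in> J \<Longrightarrow> a divides b"
proof -
  interpret domain R by fact
  interpret J: ideal J R by fact
  define K where "K = ideal_residuum R J (PIdl f)"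
  have fR: "f \<in> carrier R"
    using f by simp
  interpret F: ideal "PIdl f" R
    using fR by (rule cgenideal_ideal)
  have K: "x \<in> K \<longleftrightarrow> x \<in> carrier R \<and> (\<forall>b\<in>J. x \<otimes> b \<in> PIdl f)" for x
    by (auto simp: K_def ideal_residuum_def l_coset_def)
  have "ideal K R"
  proof (rule idealI[OF ring_axioms])
    show "subgroup K (add_monoid R)"
    proof (rule add.subgroupI)
      have "\<zero> \<in> K"
        by (auto simp: K)
      then show "K \<noteq> {}"
        by blast
    qed (auto simp: K l_distr l_minus F.a_closed F.a_inv_closed simp flip: a_inv_def)
  next
    fix x r assume xr: "x \<in> K" "r \<in> carrier R"
    have "x \<otimes> r \<otimes> b \<in> PIdl f" if "b \<in> J" for b
      using xr that J.I_l_closed[OF that xr(2)] by (simp add: K m_assoc)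
    then show *: "x \<otimes> r \<in> K"
      using xr by (simp add: K)
    then show "r \<otimes> x \<in> K"
      using xr by (simp add: K m_comm)
  qed
  have "f \<in> J \<inter> PIdl f"
    using f cgenideal_self[OF fR] by blast
  also have "\<dots> = ideal_prod R J K"
    unfolding K_def by (rule divisibility[OF J F.ideal_axioms])
  finally obtain a x where ax: "a \<in> J" "x \<in> K" "f = a \<otimes> x"
    using ideal_prod_eq_products[OF total J \<open>ideal K R\<close>] by blast
  have xR: "x \<in> carrier R" "x \<noteq> \<zero>"
    using ax f(2) K by auto
  have "a divides b" if "b \<in> J" for b
  proof -
    have "x \<otimes> b \<in> PIdl f"
      using ax(2) that by (simp add: K)
    then obtain r where r: "r \<in> carrier R" "x \<otimes> b = r \<otimes> f"
      unfolding cgenideal_def by blast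
    then have "x \<otimes> b = x \<otimes> (a \<otimes> r)"
      using ax xR by (simp add: m_ac)
    then have "b = a \<otimes> r"
      using m_lcancel[OF xR(2,1)] that ax(1) r(1) by simp
    with r(1) show ?thesis
      by (rule dividesI)
  qed
  then show ?thesis
    using that ax(1) by blast
qed

text \<open>The elements divisible by all powers of \<open>b\<close> form an ideal \<open>J\<close>
  containing \<open>g\<close>, so in a BL-ring it would have a generator \<open>a\<close>. Then
  \<open>a = b c\<close> with \<open>c\<close> again in \<open>J\<close>, hence \<open>a\<close>
  divides \<open>c\<close>, which forces \<open>b\<close> to be a unit.\<close>

lemma (in domain) not_BL_ring_if_power_divides:
  assumes total: "\<And>x y. \<lbrakk>x \<in> carrier R; y \<in> carrier R\<rbrakk> \<Longrightarrow> x divides y \<or> y divides x"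
    and b: "b \<in> carrier R" "b \<notin> Units R"
    and g: "g \<in> carrier R" "g \<noteq> \<zero>" and dvd: "\<And>n::nat. (b [^] n) divides g"
  shows "\<not> BL_ring R"
proof
  assume "BL_ring R"
  then interpret BL_ring R .
  define J where "J = {x \<in> carrier R. \<forall>n::nat. (b [^] n) divides x}"
  have b0: "b \<noteq> \<zero>"
    using dvd[of 1] b(1) g by (auto elim!: dividesE)
  have "ideal J R"
  proof (rule idealI[OF ring_axioms])
    show "subgroup J (add_monoid R)"
    proof (rule add.subgroupI)
      have "\<zero> \<in> J"
        using b by (auto simp: J_def intro!: dividesI[of \<zero>])
      then show "J \<noteq> {}"
        by blast
    next
      fix x assume "x \<in> J"
      then have x: "x \<in> carrier R" "\<And>n::nat. (b [^] n) divides x"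
        by (simp_all add: J_def)
      have "(b [^] n) divides \<ominus> x" for n :: nat
        using x(2)[of n]
      proof (rule dividesE)
        fix d assume "x = b [^] n \<otimes> d" "d \<in> carrier R"
        then show ?thesis
          using b by (intro dividesI[of "\<ominus> d"]) (simp_all add: r_minus)
      qed
      then show "\<ominus> x \<in> J"
        using x(1) by (simp add: J_def)
    next
      fix x y assume "x \<in> J" "y \<in> J"
      then have xy: "x \<in> carrier R" "y \<in> carrier R"
        "\<And>n::nat. (b [^] n) divides x" "\<And>n::nat. (b [^] n) divides y"
        by (simp_all add: J_def)
      have "(b [^] n) divides (x \<oplus> y)" for n :: nat
      proof -
        obtain d e where "d \<in> carrier R" "e \<in> carrier R" "x = b [^] n \<otimes> d" "y = b [^] n \<otimes> e"
          using xy(3,4)[of n] by (elim dividesE)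
        then show ?thesis
          using b by (intro dividesI[of "d \<oplus> e"]) (simp_all add: r_distr)
      qed
      then show "x \<oplus> y \<in> J"
        using xy(1,2) by (simp add: J_def)
    qed (auto simp: J_def)
  next
    fix x r assume "x \<in> J" "r \<in> carrier R"
    then show "r \<otimes> x \<in> J" "x \<otimes> r \<in> J"
      using b(1) by (simp_all add: J_def divides_prod_r divides_prod_l)
  qed
  then obtain a where a: "a \<in> J" "\<And>x. x \<in> J \<Longrightarrow> a divides x"
    using nonzero_ideal_principal[OF domain_axioms total, of J g] g dvd by (auto simp: J_def)
  have aR: "a \<in> carrier R" and "(b [^] (1::nat)) divides a"
    using a(1) unfolding J_def by blast+
  then obtain c where c: "c \<in> carrier R" "a = b \<otimes> c"
    using b by (auto elim!: dividesE)
  \<comment> \<open>Dividing by \<open>b\<close> does not leave \<open>J\<close>: cancel one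
    \<open>b\<close> from the divisibility of \<open>a = b c\<close> by the next higher
    power.\<close>
  have "(b [^] n) divides c" for n :: nat
  proof -
    have "(b [^] Suc n) divides a"
      using a(1) unfolding J_def by blast
    then obtain e where e: "e \<in> carrier R" "b \<otimes> c = b [^] n \<otimes> b \<otimes> e"
      using c by (auto elim!: dividesE)
    then have "b \<otimes> c = b \<otimes> (b [^] n \<otimes> e)"
      using b by (simp add: m_ac)
    then have "c = b [^] n \<otimes> e"
      using m_lcancel[OF b0 b(1)] b c e by simp
    with e(1) show ?thesis
      by (rule dividesI)
  qed
  then have "c \<in> J"
    using c by (simp add: J_def)
  then obtain d where d: "d \<in> carrier R" "c = a \<otimes> d"
    using a(2) by (auto elim!: dividesE)
  have "a \<noteq> \<zero>"
    using a(2)[of g] g dvd by (auto simp: J_def elim!: dividesE)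
  have "a \<otimes> (b \<otimes> d) = b \<otimes> (a \<otimes> d)"
    using aR b d by (simp add: m_lcomm)
  also have "\<dots> = a \<otimes> \<one>"
    using aR by (simp flip: c(2) d(2))
  finally have "a \<otimes> (b \<otimes> d) = a \<otimes> \<one>" .
  then have "b \<otimes> d = \<one>"
    using m_lcancel[OF \<open>a \<noteq> \<zero>\<close> aR] b d by simp
  then show False
    using b d m_comm[of b d] by (auto simp: Units_def)
qed

section \<open>Divisibility, zero and units in rings of fractions\<close>

context mult_subset
begin

lemma fraction_in_carrier: "\<lbrakk>r \<in> carrier R; s \<in> S\<rbrakk> \<Longrightarrow> fraction R S r s \<in> carrier (ring_of_fractions R S)"
  by (auto simp: carrier_fractions)

text \<open>An element \<open>t\<close> of \<open>S\<close> becomes invertible, so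
  \<open>t r' = u r\<close> exhibits the quotient \<open>(u s) / (t s')\<close>.\<close>

lemma fraction_dividesI:
  assumes "r \<in> carrier R" "s \<in> S" "r' \<in> carrier R" "s' \<in> S" "t \<in> S" "u \<in> carrier R" "t \<otimes> r' = u \<otimes> r"
  shows "fraction R S r s divides\<^bsub>ring_of_fractions R S\<^esub> fraction R S r' s'"
proof (rule dividesI)
  show "fraction R S (u \<otimes> s) (t \<otimes> s') \<in> carrier (ring_of_fractions R S)"
    using assms by (simp add: fraction_in_carrier S_mult)
  have "(s \<otimes> (t \<otimes> s')) \<otimes> r' = (s \<otimes> s') \<otimes> (t \<otimes> r')"
    using assms(1-6) by (simp add: m_ac)
  also have "\<dots> = s' \<otimes> (r \<otimes> (u \<otimes> s))"
    unfolding assms(7) using assms(1-6) by (simp add: m_ac)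
  finally have "fraction R S r' s' = fraction R S (r \<otimes> (u \<otimes> s)) (s \<otimes> (t \<otimes> s'))"
    using assms by (intro fraction_eqI) (auto simp: S_mult)
  then show "fraction R S r' s' = fraction R S r s \<otimes>\<^bsub>ring_of_fractions R S\<^esub> fraction R S (u \<otimes> s) (t \<otimes> s')"
    using assms by (simp add: mult_fraction S_mult)
qed

lemma fraction_eq_zero_iff:
  assumes "domain R" "\<zero> \<notin> S" "r \<in> carrier R" "s \<in> S"
  shows "fraction R S r s = \<zero>\<^bsub>ring_of_fractions R S\<^esub> \<longleftrightarrow> r = \<zero>"
proof -
  interpret domain R by fact
  have "t \<otimes> r = \<zero> \<longleftrightarrow> r = \<zero>" if "t \<in> S" for t
    using that assms integral_iff[of t r] by (metis S_in_carrier)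
  then show ?thesis
    using assms S_one by (auto simp: zero_fraction fraction_eq_iff)
qed

lemma domain_fractions:
  assumes "domain R" "\<zero> \<notin> S"
  shows "domain (ring_of_fractions R S)"
proof -
  interpret domain R by fact
  interpret L: cring "ring_of_fractions R S"
    by (rule cring_fractions)
  show ?thesis
  proof
    show "\<one>\<^bsub>ring_of_fractions R S\<^esub> \<noteq> \<zero>\<^bsub>ring_of_fractions R S\<^esub>"
      unfolding one_fraction using fraction_eq_zero_iff[OF assms one_closed S_one] by simp
    fix x y assume xy: "x \<otimes>\<^bsub>ring_of_fractions R S\<^esub> y = \<zero>\<^bsub>ring_of_fractions R S\<^esub>"
      "x \<in> carrier (ring_of_fractions R S)" "y \<in> carrier (ring_of_fractions R S)"
    then obtain a b c d where *: "x = fraction R S a b" "y = fraction R S c d"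
      "a \<in> carrier R" "b \<in> S" "c \<in> carrier R" "d \<in> S"
      unfolding carrier_fractions by blast
    then have "fraction R S (a \<otimes> c) (b \<otimes> d) = \<zero>\<^bsub>ring_of_fractions R S\<^esub>"
      using xy by (simp add: mult_fraction)
    then have "a \<otimes> c = \<zero>"
      using * by (subst (asm) fraction_eq_zero_iff[OF assms]) (auto simp: S_mult)
    then show "x = \<zero>\<^bsub>ring_of_fractions R S\<^esub> \<or> y = \<zero>\<^bsub>ring_of_fractions R S\<^esub>"
      using * integral_iff[of a c] by (simp add: fraction_eq_zero_iff[OF assms])
  qed
qed

lemma fraction_pow:
  assumes "r \<in> carrier R"
  shows "fraction R S r \<one> [^]\<^bsub>ring_of_fractions R S\<^esub> (n::nat) = fraction R S (r [^] n) \<one>"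
  by (induction n) (use assms S_one in \<open>simp_all add: one_fraction mult_fraction\<close>)

end

text \<open>An inverse \<open>c / d\<close> would give \<open>t b c = t s d\<close> for some
  \<open>t\<close> outside \<open>P\<close>; the left side lies in \<open>P\<close>, while the right
  side is a product of elements outside the prime ideal.\<close>

lemma fraction_not_unit:
  fixes R (structure)
  assumes "primeideal P R" "b \<in> P" "s \<in> carrier R - P"
  shows "fraction R (carrier R - P) b s \<notin> Units (localization_at R P)"
proof
  interpret primeideal P R by fact
  interpret mult_subset R "carrier R - P"
    using assms(1) by (rule mult_subset_compl_primeideal)
  assume "fraction R (carrier R - P) b s \<in> Units (localization_at R P)"
  then obtain y where y: "y \<in> carrier (ring_of_fractions R (carrier R - P))"
    "fraction R (carrier R - P) b s \<otimes>\<^bsub>ring_of_fractions R (carrier R - P)\<^esub> y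
      = \<one>\<^bsub>ring_of_fractions R (carrier R - P)\<^esub>"
    by (auto simp: Units_def localization_at_def)
  then obtain c d where cd: "y = fraction R (carrier R - P) c d" "c \<in> carrier R" "d \<in> carrier R - P"
    unfolding carrier_fractions by blast
  have "fraction R (carrier R - P) (b \<otimes> c) (s \<otimes> d) = fraction R (carrier R - P) \<one> \<one>"
    using y(2) assms cd by (simp add: mult_fraction one_fraction)
  then obtain t where t: "t \<in> carrier R - P" "t \<otimes> (\<one> \<otimes> (b \<otimes> c)) = t \<otimes> (s \<otimes> d \<otimes> \<one>)"
    using assms cd S_mult S_one by (subst (asm) fraction_eq_iff) auto
  have "t \<otimes> (s \<otimes> d \<otimes> \<one>) \<in> carrier R - P"
    using t(1) assms(3) cd(3) S_mult S_one by simp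
  moreover have "t \<otimes> (\<one> \<otimes> (b \<otimes> c)) \<in> P"
    using assms(2) cd(2) t(1) by (simp add: I_l_closed I_r_closed)
  ultimately show False
    unfolding t(2) by blast
qed

section \<open>Entire functions with prescribed zeros\<close>

text \<open>Identity theorem on the connected plane. This provides the side condition under which
  \<open>zorder\<close> behaves as the order of vanishing.\<close>

lemma entire_eventually_nonzero:
  assumes "f holomorphic_on UNIV" "f \<noteq> (\<lambda>_. 0)"
  shows "eventually (\<lambda>w. f w \<noteq> 0) (at z)"
proof -
  obtain w where "f w \<noteq> 0"
    using assms(2) by auto
  then show ?thesis
    using non_zero_neighbour_alt[OF assms(1) open_UNIV connected_UNIV, of z w] by simp
qed

lemma entire_analytic: "f holomorphic_on UNIV \<Longrightarrow> f analytic_on {z}"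
  using analytic_at by blast

lemma zorder_entire_nonneg:
  assumes "f holomorphic_on UNIV" "f \<noteq> (\<lambda>_. 0)"
  shows "zorder f z \<ge> 0"
  using assms by (intro zorder_ge_0 entire_analytic eventually_frequently entire_eventually_nonzero) auto

lemma zorder_entire_eq_0_iff:
  assumes "f holomorphic_on UNIV" "f \<noteq> (\<lambda>_. 0)"
  shows "zorder f z = 0 \<longleftrightarrow> f z \<noteq> 0"
  using assms by (intro zorder_eq_0_iff entire_analytic eventually_frequently entire_eventually_nonzero) auto

lemma entire_mult_nonzero:
  assumes "f holomorphic_on UNIV" "f \<noteq> (\<lambda>_. 0)" "g holomorphic_on UNIV" "g \<noteq> (\<lambda>_. 0)"
  shows "(\<lambda>z. f z * g z) \<noteq> (\<lambda>_. 0)"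
proof
  assume *: "(\<lambda>z. f z * g z) = (\<lambda>_. 0)"
  have "eventually (\<lambda>w. f w \<noteq> 0 \<and> g w \<noteq> 0) (at 0)"
    using assms by (intro eventually_conj entire_eventually_nonzero)
  then obtain w where "f w \<noteq> 0 \<and> g w \<noteq> 0"
    using eventually_happens'[OF at_neq_bot] by blast
  then show False
    using fun_cong[OF *, of w] by simp
qed

lemma zorder_entire_mult:
  assumes "f holomorphic_on UNIV" "f \<noteq> (\<lambda>_. 0)" "g holomorphic_on UNIV" "g \<noteq> (\<lambda>_. 0)"
  shows "zorder (\<lambda>z. f z * g z) z = zorder f z + zorder g z"
  using assms
  by (intro zorder_times_analytic entire_analytic entire_eventually_nonzero entire_mult_nonzero holomorphic_intros)

lemma zorder_entire_power:
  assumes "f holomorphic_on UNIV" "f \<noteq> (\<lambda>_. 0)"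
  shows "zorder (\<lambda>z. f z ^ n) z = int n * zorder f z"
  using assms
  by (intro zorder_power analytic_on_imp_meromorphic_on entire_analytic eventually_frequently entire_eventually_nonzero) auto

text \<open>Infinitely many zeros in a compact disc would accumulate, against their
  isolation.\<close>

lemma finite_zeros_cball:
  assumes "f holomorphic_on UNIV" "f \<noteq> (\<lambda>_. 0)"
  shows "finite ({z. f z = 0} \<inter> cball a r)"
proof (rule ccontr)
  assume "infinite ({z. f z = 0} \<inter> cball a r)"
  then obtain x where x: "x islimpt ({z. f z = 0} \<inter> cball a r)"
    using Heine_Borel_imp_Bolzano_Weierstrass[OF compact_cball, of "{z. f z = 0} \<inter> cball a r" a r] by auto
  have "eventually (\<lambda>w. w \<notin> {z. f z = 0} \<inter> cball a r) (at x)"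
    using entire_eventually_nonzero[OF assms] by (rule eventually_mono) auto
  then show False
    using x by (simp add: islimpt_iff_eventually)
qed

lemma zorder_linear_power: "zorder (\<lambda>w. (w - a) ^ n) z = (if z = a then int n else 0)"
proof (cases "z = a")
  case True
  then show ?thesis
    by (auto intro: zorder_eqI[of UNIV _ "\<lambda>_. 1"])
next
  case False
  then show ?thesis
    by (auto intro!: zorder_eq_0I analytic_intros)
qed

lemma zorder_prod_linear_powers:
  assumes "finite K"
  shows "zorder (\<lambda>w. \<Prod>k\<in>K. (w - a k) ^ c k) z = (\<Sum>k\<in>K. if a k = z then int (c k) else 0)"
proof -
  have "eventually (\<lambda>w. \<forall>k\<in>K. w \<noteq> a k) (at z)"
    using assms by (intro eventually_ball_finite) (auto simp: eventually_neq_at_within)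
  then have "eventually (\<lambda>w. (\<Prod>k\<in>K. (w - a k) ^ c k) \<noteq> 0) (at z)"
    by (rule eventually_mono) (use assms in auto)
  then have "zorder (\<lambda>w. \<Prod>k\<in>K. (w - a k) ^ c k) z = (\<Sum>k\<in>K. zorder (\<lambda>w. (w - a k) ^ c k) z)"
    by (intro zorder_prod_analytic analytic_intros)
  then show ?thesis
    by (simp add: zorder_linear_power eq_commute)
qed

lemma zorder_prod_distinct_linear_powers:
  assumes "finite A"
  shows "zorder (\<lambda>w. \<Prod>a\<in>A. (w - a) ^ c a) z = (if z \<in> A then int (c z) else 0)"
  using assms zorder_prod_linear_powers[OF assms, of "\<lambda>a. a" c z] by simp

lemma locally_finite_closed:
  fixes A :: "complex set"
  assumes "\<And>r. finite (A \<inter> cball 0 r)"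
  shows "closed A"
proof -
  have "\<not> z islimpt A" for z
  proof
    assume "z islimpt A"
    then have "z islimpt (A \<inter> ball 0 (norm z + 1))"
      by (intro islimpt_Int_eventually eventually_at_in_open') auto
    moreover have "A \<inter> ball 0 (norm z + 1) \<subseteq> A \<inter> cball 0 (norm z + 1)"
      by auto
    ultimately show False
      using assms finite_subset islimpt_finite by metis
  qed
  then show ?thesis
    by (simp add: closed_limpt)
qed

text \<open>Repetitions record multiplicities: such a sequence serves as the zeros of a Weierstrass
  product and as the nodes of an interpolation with multiplicities.\<close>

lemma enumeration_with_multiplicities:
  fixes A :: "complex set" and c :: "complex \<Rightarrow> nat"
  assumes "infinite A" "\<And>r. finite (A \<inter> cball 0 r)" "\<And>z. z \<in> A \<Longrightarrow> c z > 0"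
  shows "\<exists>a :: nat \<Rightarrow> complex. range a = A \<and> filterlim a at_infinity sequentially \<and>
    (\<forall>z\<in>A. finite (a -` {z}) \<and> card (a -` {z}) = c z)"
proof (rule sequence_of_sparse_set_exists'[where A = A and c = c])
  show "closed A"
    using assms(2) by (rule locally_finite_closed)
qed (use assms in auto)

text \<open>Weierstrass' theorem: a polynomial realizes finitely many zeros, a Weierstrass product
  infinitely many.\<close>

lemma entire_with_orders:
  fixes c :: "complex \<Rightarrow> nat"
  assumes "\<And>r. finite ({z. c z > 0} \<inter> cball 0 r)"
  obtains f where "f holomorphic_on UNIV" "f \<noteq> (\<lambda>_. 0)" "\<And>z. zorder f z = int (c z)"
proof (cases "finite {z. c z > 0}")
  case True
  let ?f = "\<lambda>w. \<Prod>a\<in>{z. c z > 0}. (w - a) ^ c a"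
  have "\<exists>w. w \<notin> {z. c z > 0}"
    using True ex_new_if_finite infinite_UNIV_char_0 by blast
  then obtain w where "w \<notin> {z. c z > 0}" ..
  then have "?f w \<noteq> 0"
    using True by auto
  then have "?f \<noteq> (\<lambda>_. 0)"
    by metis
  moreover have "?f holomorphic_on UNIV"
    by (intro holomorphic_intros)
  ultimately show ?thesis
    using that[of ?f] unfolding zorder_prod_distinct_linear_powers[OF True] by simp
next
  case False
  \<comment> \<open>The Weierstrass product takes nonzero zeros only, so the origin is set
    aside.\<close>
  define A where "A = {z. c z > 0} - {0}"
  have fin: "finite (A \<inter> cball 0 r)" for r
    by (rule finite_subset[OF _ assms[of r]]) (auto simp: A_def)
  have "\<exists>a :: nat \<Rightarrow> complex. range a = A \<and> filterlim a at_infinity sequentially \<and>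
      (\<forall>z\<in>A. finite (a -` {z}) \<and> card (a -` {z}) = c z)"
    by (rule enumeration_with_multiplicities[OF _ fin]) (use False in \<open>simp_all add: A_def\<close>)
  then obtain a where a: "range a = A" "filterlim a at_infinity sequentially"
      "\<forall>z\<in>A. finite (a -` {z}) \<and> card (a -` {z}) = c z"
    by (elim exE conjE)
  have "a n \<in> A" for n
    using a(1) by blast
  then have nz: "a n \<noteq> 0" for n
    by (simp add: A_def)
  interpret W: weierstrass_product' a
    by unfold_locales (use nz a(2,3) in \<open>simp_all add: a(1)\<close>)
  have "W.f 0 \<noteq> 0"
    using nz by (simp add: W.zero image_iff)
  then have W: "W.f holomorphic_on UNIV" "W.f \<noteq> (\<lambda>_. 0)"
    using W.holomorphic by auto
  have ord: "zorder W.f z = (if z = 0 then 0 else int (c z))" for z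
  proof (cases "z \<in> A")
    case False
    then have "a -` {z} = {}"
      using a(1) by auto
    then show ?thesis
      using False by (simp add: W.zorder A_def split: if_split) blast
  next
    case True
    then show ?thesis
      using a(3) by (simp add: W.zorder A_def)
  qed
  \<comment> \<open>This factor restores the order at the origin; the form \<open>z - 0\<close>
    matches \<open>zorder_linear_power\<close>.\<close>
  let ?p = "\<lambda>z. (z - 0) ^ c 0 :: complex"
  have p: "?p holomorphic_on UNIV" "?p \<noteq> (\<lambda>_. 0)"
    by (intro holomorphic_intros) (metis diff_zero power_one zero_neq_one)
  show ?thesis
  proof (rule that)
    show "(\<lambda>z. ?p z * W.f z) holomorphic_on UNIV"
      using p W by (intro holomorphic_intros)
    show "(\<lambda>z. ?p z * W.f z) \<noteq> (\<lambda>_. 0)"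
      using p W by (rule entire_mult_nonzero)
    show "zorder (\<lambda>z. ?p z * W.f z) z = int (c z)" for z
      unfolding zorder_entire_mult[OF p W] zorder_linear_power ord by auto
  qed
qed

text \<open>Multiply \<open>f\<close> by an entire \<open>g\<close> that supplies the missing
  orders. Then \<open>f g\<close> and \<open>h\<close> have the same zeros with the same orders, so
  they differ by a nowhere vanishing entire factor.\<close>

lemma entire_dvd_of_zorder_le:
  assumes f: "f holomorphic_on UNIV" "f \<noteq> (\<lambda>_. 0)" and h: "h holomorphic_on UNIV" "h \<noteq> (\<lambda>_. 0)"
    and le: "\<And>z. zorder f z \<le> zorder h z"
  obtains k where "k holomorphic_on UNIV" "k \<noteq> (\<lambda>_. 0)" "\<And>z. h z = f z * k z"
proof -
  define c where "c z = nat (zorder h z - zorder f z)" for z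
  have "h z = 0" if "c z > 0" for z
    using that zorder_entire_eq_0_iff[OF h, of z] zorder_entire_nonneg[OF f, of z] by (auto simp: c_def)
  then have "{z. c z > 0} \<subseteq> {z. h z = 0}"
    by blast
  then have "finite ({z. c z > 0} \<inter> cball 0 r)" for r
    using finite_subset[OF _ finite_zeros_cball[OF h, of 0 r]] by blast
  then obtain g where g: "g holomorphic_on UNIV" "g \<noteq> (\<lambda>_. 0)" "\<And>z. zorder g z = int (c z)"
    using entire_with_orders by blast
  let ?fg = "\<lambda>z. f z * g z"
  have fg: "?fg holomorphic_on UNIV" "?fg \<noteq> (\<lambda>_. 0)"
    using f g entire_mult_nonzero by (auto intro: holomorphic_intros)
  have ord: "zorder ?fg z = zorder h z" for z
    unfolding zorder_entire_mult[OF f g(1,2)] using le[of z] by (simp add: g(3) c_def)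
  obtain u where u: "u holomorphic_on UNIV" "\<And>z. u z \<noteq> 0" "\<And>z. h z = u z * ?fg z"
  proof (rule holomorphic_zorder_factorization[OF h(1) open_UNIV connected_UNIV fg(1)])
    show "?fg z = 0 \<longleftrightarrow> h z = 0" for z
      using ord[of z] zorder_entire_eq_0_iff[OF fg, of z] zorder_entire_eq_0_iff[OF h, of z] by auto
  qed (use ord in auto)
  show ?thesis
  proof
    show "(\<lambda>z. g z * u z) holomorphic_on UNIV"
      using g u by (auto intro: holomorphic_intros)
    show "(\<lambda>z. g z * u z) \<noteq> (\<lambda>_. 0)"
      using g u by (auto simp: fun_eq_iff)
    show "h z = f z * (g z * u z)" for z
      using u(3) by simp
  qed
qed

text \<open>Take \<open>d\<close> with the pointwise minimum of the two orders: at each point one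
  cofactor is left with order 0.\<close>

lemma entire_gcd:
  assumes f: "f holomorphic_on UNIV" "f \<noteq> (\<lambda>_. 0)" and g: "g holomorphic_on UNIV" "g \<noteq> (\<lambda>_. 0)"
  obtains d f' g' where "d holomorphic_on UNIV" "f' holomorphic_on UNIV" "g' holomorphic_on UNIV"
    "f' \<noteq> (\<lambda>_. 0)" "g' \<noteq> (\<lambda>_. 0)"
    "\<And>z. f z = d z * f' z" "\<And>z. g z = d z * g' z" "\<And>z. f' z \<noteq> 0 \<or> g' z \<noteq> 0"
proof -
  define c where "c z = nat (min (zorder f z) (zorder g z))" for z
  have "{z. c z > 0} \<subseteq> {z. f z = 0}"
    using zorder_entire_eq_0_iff[OF f] by (force simp: c_def)
  then have "finite ({z. c z > 0} \<inter> cball 0 r)" for r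
    using finite_subset[OF _ finite_zeros_cball[OF f, of 0 r]] by blast
  then obtain d where d: "d holomorphic_on UNIV" "d \<noteq> (\<lambda>_. 0)" "\<And>z. zorder d z = int (c z)"
    using entire_with_orders by blast
  have ord: "zorder d z = min (zorder f z) (zorder g z)" for z
    using zorder_entire_nonneg[OF f, of z] zorder_entire_nonneg[OF g, of z] by (simp add: d c_def)
  obtain f' where f': "f' holomorphic_on UNIV" "f' \<noteq> (\<lambda>_. 0)" "\<And>z. f z = d z * f' z"
    by (rule entire_dvd_of_zorder_le[OF d(1,2) f]) (auto simp: ord)
  obtain g' where g': "g' holomorphic_on UNIV" "g' \<noteq> (\<lambda>_. 0)" "\<And>z. g z = d z * g' z"
    by (rule entire_dvd_of_zorder_le[OF d(1,2) g]) (auto simp: ord)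
  have "f = (\<lambda>z. d z * f' z)" "g = (\<lambda>z. d z * g' z)"
    using f'(3) g'(3) by auto
  then have "zorder f z = zorder d z + zorder f' z" "zorder g z = zorder d z + zorder g' z" for z
    using zorder_entire_mult[OF d(1,2) f'(1,2)] zorder_entire_mult[OF d(1,2) g'(1,2)] by auto
  then have "zorder f' z = 0 \<or> zorder g' z = 0" for z
    using ord[of z] by (smt (verit))
  then show ?thesis
    using that d f' g' zorder_entire_eq_0_iff[OF f'(1,2)] zorder_entire_eq_0_iff[OF g'(1,2)] by blast
qed

section \<open>Coprime entire functions generate the unit ideal\<close>

text \<open>The difference quotient at \<open>a\<close>, completed by the derivative, has a
  removable singularity.\<close>

lemma entire_divide_linear:
  assumes "h holomorphic_on UNIV" "h a = 0"
  obtains k where "k holomorphic_on UNIV" "\<And>z. h z = (z - a) * k z"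
proof
  show "(\<lambda>z. if z = a then deriv h a else (h z - h a) / (z - a)) holomorphic_on UNIV"
    using assms by (intro pole_lemma_open) auto
qed (use assms in auto)

text \<open>The function \<open>c (z / a) ^ N\<close> has value \<open>c\<close> at
  \<open>a\<close>, and on the disc of half the radius its norm is at most
  \<open>norm c / 2 ^ N\<close>. For \<open>a = 0\<close> the bound is vacuous and a constant
  suffices.\<close>

lemma entire_small_with_value:
  fixes a c :: complex and B :: real
  assumes "B > 0"
  obtains t where "t holomorphic_on UNIV" "t a = c"
    "\<And>z. \<lbrakk>a \<noteq> 0; norm z \<le> norm a / 2\<rbrakk> \<Longrightarrow> norm (t z) \<le> B"
proof (cases "a = 0")
  case True
  then show ?thesis
    using that[of "\<lambda>_. c"] by simp
next
  case False
  have "(\<lambda>N. norm c * (1 / 2) ^ N) \<longlonglongrightarrow> norm c * 0"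
    by (intro tendsto_intros LIMSEQ_power_zero) auto
  then have "eventually (\<lambda>N. norm c * (1 / 2) ^ N < B) sequentially"
    using assms by (intro order_tendstoD) auto
  then obtain N where N: "norm c * (1 / 2) ^ N < B"
    by (auto simp: eventually_sequentially)
  show ?thesis
  proof
    show "(\<lambda>z. c * (z / a) ^ N) holomorphic_on UNIV"
      using False by (intro holomorphic_intros)
    show "c * (a / a) ^ N = c"
      using False by simp
    fix z :: complex
    assume "norm z \<le> norm a / 2"
    then have "norm (z / a) \<le> 1 / 2"
      using False by (simp add: norm_divide field_simps)
    then have "norm c * norm (z / a) ^ N \<le> norm c * (1 / 2) ^ N"
      by (intro mult_left_mono power_mono) auto
    then show "norm (c * (z / a) ^ N) \<le> B"
      using N by (simp add: norm_mult norm_power)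
  qed
qed

text \<open>Newton interpolation of \<open>1/g\<close> with nodes \<open>a 0, a 1, \<dots>\<close>: the interpolant is
  \<open>\<Sum>k. t k z * (\<Prod>j<k. z - a j)\<close>, and \<open>h n\<close> is the remainder after \<open>n\<close> terms divided by \<open>\<Prod>j<n. z - a j\<close>.
  The coefficients are taken to be multiples of \<open>(z / a n) ^ N\<close> rather than constants, so that they
  can be made arbitrarily small on \<open>\<bar>z\<bar> \<le> \<bar>a n\<bar> / 2\<close>.\<close>

lemma newton_interpolation_steps:
  fixes a :: "nat \<Rightarrow> complex" and B :: "nat \<Rightarrow> real"
  assumes g: "g holomorphic_on UNIV" "\<And>n. g (a n) \<noteq> 0" and B: "\<And>n. B n > 0"
  obtains h t where "\<And>n. h n holomorphic_on UNIV" "\<And>n. t n holomorphic_on UNIV"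
    "h 0 = (\<lambda>_. 1)" "\<And>n z. h n z - t n z * g z = (z - a n) * h (Suc n) z"
    "\<And>n z. \<lbrakk>a n \<noteq> 0; norm z \<le> norm (a n) / 2\<rbrakk> \<Longrightarrow> norm (t n z) \<le> B n"
proof -
  \<comment> \<open>A state is the pair of remainder \<open>h n\<close> and coefficient
    \<open>t n\<close>. By \<open>P\<close> the difference \<open>h n - t n g\<close> vanishes at
    \<open>a n\<close>; \<open>Q\<close> divides it by \<open>z - a n\<close> to get the next
    remainder.\<close>
  define P where "P n p \<longleftrightarrow> fst p holomorphic_on UNIV \<and> snd p holomorphic_on UNIV \<and>
      snd p (a n) * g (a n) = fst p (a n) \<and> (n = 0 \<longrightarrow> fst p = (\<lambda>_. 1)) \<and>
      (\<forall>z. a n \<noteq> 0 \<longrightarrow> norm z \<le> norm (a n) / 2 \<longrightarrow> norm (snd p z) \<le> B n)" for n p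
  define Q where "Q n p q \<longleftrightarrow> (\<forall>z. fst p z - snd p z * g z = (z - a n) * fst q z)"
    for n and p q :: "(complex \<Rightarrow> complex) \<times> (complex \<Rightarrow> complex)"
  have ex: "\<exists>t. P n (h, t)" if "h holomorphic_on UNIV" "n = 0 \<longrightarrow> h = (\<lambda>_. 1)" for n h
  proof -
    obtain t where "t holomorphic_on UNIV" "t (a n) = h (a n) / g (a n)"
      "\<And>z. \<lbrakk>a n \<noteq> 0; norm z \<le> norm (a n) / 2\<rbrakk> \<Longrightarrow> norm (t z) \<le> B n"
      using entire_small_with_value[OF B] by metis
    then have "P n (h, t)"
      using that g(2)[of n] by (simp add: P_def)
    then show ?thesis
      by blast
  qed
  have "\<exists>p. \<forall>n. P n (p n) \<and> Q n (p n) (p (Suc n))"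
  proof (rule dependent_nat_choice)
    show "\<exists>p. P 0 p"
      using ex[of "\<lambda>_. 1" 0] by auto
    fix p n
    assume p: "P n p"
    have "(\<lambda>z. fst p z - snd p z * g z) holomorphic_on UNIV" "fst p (a n) - snd p (a n) * g (a n) = 0"
      using p g(1) by (auto simp: P_def intro!: holomorphic_intros)
    then obtain h where h: "h holomorphic_on UNIV" "\<And>z. fst p z - snd p z * g z = (z - a n) * h z"
      by (rule entire_divide_linear) blast
    then obtain t where "P (Suc n) (h, t)"
      using ex[of h "Suc n"] by auto
    then show "\<exists>q. P (Suc n) q \<and> Q n p q"
      using h(2) by (auto simp: Q_def)
  qed
  then obtain p where p: "\<And>n. P n (p n)" "\<And>n. Q n (p n) (p (Suc n))"
    by blast
  show ?thesis
    by (rule that[of "\<lambda>n. fst (p n)" "\<lambda>n. snd (p n)"]) (use p in \<open>auto simp: P_def Q_def\<close>)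
qed

text \<open>Weierstrass M-test on every disc. The index from which the common majorant applies may
  depend on the radius, which affects neither summability nor locally uniform convergence.\<close>

lemma entire_suminf:
  fixes F :: "nat \<Rightarrow> complex \<Rightarrow> complex"
  assumes hol: "\<And>n. F n holomorphic_on UNIV" and M: "summable M"
    and bound: "\<And>R. R > 0 \<Longrightarrow> eventually (\<lambda>n. \<forall>z\<in>cball 0 R. norm (F n z) \<le> M n) sequentially"
  shows "(\<lambda>z. suminf (\<lambda>n. F n z)) holomorphic_on UNIV" "summable (\<lambda>n. F n z)"
proof -
  show "(\<lambda>z. suminf (\<lambda>n. F n z)) holomorphic_on UNIV"
  proof (rule holomorphic_uniform_sequence)
    fix z :: complex
    have "uniform_limit (cball 0 (norm z + 1)) (\<lambda>n z. \<Sum>i<n. F i z) (\<lambda>z. suminf (\<lambda>i. F i z)) sequentially"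
      by (rule Weierstrass_m_test_ev[OF bound M]) (auto intro: add_nonneg_pos)
    then have "uniform_limit (cball z 1) (\<lambda>n z. \<Sum>i<n. F i z) (\<lambda>z. suminf (\<lambda>i. F i z)) sequentially"
      by (rule uniform_limit_on_subset) (simp add: cball_subset_cball_iff)
    then show "\<exists>d>0. cball z d \<subseteq> UNIV \<and>
        uniform_limit (cball z d) (\<lambda>n z. \<Sum>i<n. F i z) (\<lambda>z. suminf (\<lambda>i. F i z)) sequentially"
      by (intro exI[of _ 1]) auto
  qed (auto intro!: holomorphic_intros hol)
  have "eventually (\<lambda>n. \<forall>w\<in>cball 0 (norm z + 1). norm (F n w) \<le> M n) sequentially"
    by (rule bound) (auto intro: add_nonneg_pos)
  then have "eventually (\<lambda>n. norm (F n z) \<le> M n) sequentially"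
    by (rule eventually_mono) auto
  then show "summable (\<lambda>n. F n z)"
    using M by (rule summable_comparison_test_ev)
qed

text \<open>Here \<open>v\<close> is the sum of the Newton series. Its tails \<open>S n\<close> and
  the remainders \<open>h n\<close> obey parallel recursions, so \<open>w n = h n - S n g\<close>
  satisfies \<open>w n = (z - a n) w (n + 1)\<close>. Iterating from \<open>w 0 = 1 - v g\<close>
  splits off the linear factors.\<close>

lemma entire_interpolation:
  fixes a :: "nat \<Rightarrow> complex"
  assumes a: "filterlim a at_infinity sequentially"
    and g: "g holomorphic_on UNIV" "\<And>n. g (a n) \<noteq> 0"
  obtains v where "v holomorphic_on UNIV"
    "\<And>n. \<exists>w. w holomorphic_on UNIV \<and> (\<forall>z. 1 - v z * g z = (\<Prod>k<n. z - a k) * w z)"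
proof -
  \<comment> \<open>On the disc of radius \<open>norm (a n) / 2\<close> this bounds the product of
    the \<open>z - a j\<close> with \<open>j < n\<close>. The summand 1 makes every factor at least
    1, so partial products are bounded as well.\<close>
  define D where "D n = (\<Prod>j<n. 1 + norm (a n) + norm (a j))" for n
  have D: "D n > 0" for n
    unfolding D_def by (intro prod_pos ballI add_pos_nonneg) auto
  obtain h t where h: "\<And>n. h n holomorphic_on UNIV" and t: "\<And>n. t n holomorphic_on UNIV"
    and h0: "h 0 = (\<lambda>_. 1)" and step: "\<And>n z. h n z - t n z * g z = (z - a n) * h (Suc n) z"
    and small: "\<And>n z. \<lbrakk>a n \<noteq> 0; norm z \<le> norm (a n) / 2\<rbrakk> \<Longrightarrow> norm (t n z) \<le> (1 / 2) ^ n / D n"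
    by (rule newton_interpolation_steps[where a = a and B = "\<lambda>n. (1 / 2) ^ n / D n", OF g])
       (use D in \<open>simp, blast\<close>)
  \<comment> \<open>The \<open>k\<close>-th term of the Newton series restarted at node
    \<open>n\<close>.\<close>
  define F where "F n k z = t (n + k) z * (\<Prod>j<k. z - a (n + j))" for n k z
  have F_hol: "F n k holomorphic_on UNIV" for n k
    unfolding F_def by (intro holomorphic_intros t)
  have F_bound: "eventually (\<lambda>k. \<forall>z\<in>cball 0 R. norm (F n k z) \<le> (1 / 2) ^ k) sequentially"
    if "R > 0" for n R
  proof -
    \<comment> \<open>As the nodes tend to infinity, a fixed disc eventually lies where the
      coefficients are small.\<close>
    have "eventually (\<lambda>k. 2 * R \<le> norm (a k)) sequentially"
      using a by (auto simp: filterlim_at_infinity_conv_norm_at_top filterlim_at_top)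
    then have "eventually (\<lambda>k. 2 * R \<le> norm (a (k + n))) sequentially"
      by (rule eventually_all_ge_at_top[THEN eventually_mono, THEN eventually_sequentially_seg[THEN iffD2]]) auto
    then show ?thesis
    proof eventually_elim
      case (elim k)
      show ?case
      proof
        fix z :: complex
        assume z: "z \<in> cball 0 R"
        have "a (n + k) \<noteq> 0" "norm z \<le> norm (a (n + k)) / 2"
          using elim z that by (auto simp: add.commute)
        then have 1: "norm (t (n + k) z) \<le> (1 / 2) ^ (n + k) / D (n + k)"
          by (rule small)
        have "norm (z - a j) \<le> 1 + norm (a (n + k)) + norm (a j)" for j
          using norm_triangle_ineq4[of z "a j"] elim z that by (simp add: add.commute)
        then have "(\<Prod>j\<in>{n..<n + k}. norm (z - a j)) \<le> (\<Prod>j\<in>{n..<n + k}. 1 + norm (a (n + k)) + norm (a j))"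
          by (intro prod_mono) auto
        \<comment> \<open>The added factors, those with \<open>j < n\<close>, are at least
          1.\<close>
        also have "\<dots> \<le> D (n + k)"
          unfolding D_def by (intro prod_mono2) auto
        also have "(\<Prod>j\<in>{n..<n + k}. norm (z - a j)) = norm (\<Prod>j<k. z - a (n + j))"
          using prod.shift_bounds_nat_ivl[of "\<lambda>j. norm (z - a j)" 0 n k]
          by (simp add: prod_norm atLeast0LessThan add.commute)
        finally have 2: "norm (\<Prod>j<k. z - a (n + j)) \<le> D (n + k)" .
        have "norm (F n k z) \<le> (1 / 2) ^ (n + k) / D (n + k) * D (n + k)"
          unfolding F_def norm_mult using D[of "n + k"] by (intro mult_mono 1 2) auto
        also have "\<dots> = (1 / 2) ^ (n + k)"
          using D[of "n + k"] by simp
        also have "\<dots> \<le> (1 / 2) ^ k"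
          by (intro power_decreasing) auto
        finally show "norm (F n k z) \<le> (1 / 2) ^ k" .
      qed
    qed
  qed
  define S where "S n z = suminf (\<lambda>k. F n k z)" for n z
  have M: "summable (\<lambda>k. (1 / 2) ^ k :: real)"
    by (rule summable_geometric) simp
  have S_hol: "S n holomorphic_on UNIV" and F_summable: "summable (\<lambda>k. F n k z)" for n z
    using entire_suminf[of "F n", OF F_hol M F_bound] by (auto simp: S_def[abs_def])
  \<comment> \<open>Split off the first term and factor \<open>z - a n\<close> out of the
    others.\<close>
  have S_step: "S n z = t n z + (z - a n) * S (Suc n) z" for n z
  proof -
    have "F n (Suc k) z = (z - a n) * F (Suc n) k z" for k
      by (simp add: F_def prod.lessThan_Suc_shift del: prod.lessThan_Suc)
    then have "(z - a n) * S (Suc n) z = suminf (\<lambda>k. F n (Suc k) z)"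
      using suminf_mult[OF F_summable, of "z - a n" "Suc n" z] by (simp add: S_def)
    also have "\<dots> = S n z - F n 0 z"
      unfolding S_def by (rule suminf_split_head[OF F_summable])
    finally show ?thesis
      by (simp add: F_def)
  qed
  define w where "w n z = h n z - S n z * g z" for n z
  have w_hol: "w n holomorphic_on UNIV" for n
    unfolding w_def by (intro holomorphic_intros h S_hol g)
  have w_step: "w n z = (z - a n) * w (Suc n) z" for n z
    using step[of n z] by (simp add: w_def S_step[of n z] algebra_simps)
  have "w 0 z = (\<Prod>k<n. z - a k) * w n z" for n z
    by (induction n) (simp_all add: w_step[of _ z, symmetric] mult.assoc)
  then have "1 - S 0 z * g z = (\<Prod>k<n. z - a k) * w n z" for n z
    by (simp add: w_def h0)
  then show ?thesis
    using that[of "S 0"] S_hol w_hol by blast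
qed

text \<open>Interpolate \<open>1/g\<close> at the zeros of \<open>f\<close>, repeated by
  multiplicity. Then \<open>1 - v g\<close> vanishes at each zero of \<open>f\<close> at least to
  the order of \<open>f\<close>, hence is a multiple of \<open>f\<close>. The zero set is infinite
  so that a sequence tending to infinity enumerates it.\<close>

lemma entire_bezout:
  assumes f: "f holomorphic_on UNIV" "f \<noteq> (\<lambda>_. 0)" "infinite {z. f z = 0}"
    and g: "g holomorphic_on UNIV" and coprime: "\<And>z. f z \<noteq> 0 \<or> g z \<noteq> 0"
  obtains u v where "u holomorphic_on UNIV" "v holomorphic_on UNIV" "\<And>z. u z * f z + v z * g z = 1"
proof -
  let ?Z = "{z. f z = 0}"
  define c where "c z = nat (zorder f z)" for z
  note fin = finite_zeros_cball[OF f(1,2), of 0]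
  have c: "zorder f z = int (c z)" for z
    using zorder_entire_nonneg[OF f(1,2)] by (simp add: c_def)
  have "c z > 0" if "z \<in> ?Z" for z
    using that zorder_entire_eq_0_iff[OF f(1,2), of z] c[of z] by simp
  then have "\<exists>a :: nat \<Rightarrow> complex. range a = ?Z \<and> filterlim a at_infinity sequentially \<and>
      (\<forall>z\<in>?Z. finite (a -` {z}) \<and> card (a -` {z}) = c z)"
    by (rule enumeration_with_multiplicities[OF f(3) fin])
  then obtain a where a: "range a = ?Z" "filterlim a at_infinity sequentially"
      "\<forall>z\<in>?Z. finite (a -` {z}) \<and> card (a -` {z}) = c z"
    by (elim exE conjE)
  have "g (a n) \<noteq> 0" for n
    using a(1) coprime[of "a n"] by auto
  then obtain v where v: "v holomorphic_on UNIV"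
    "\<And>n. \<exists>w. w holomorphic_on UNIV \<and> (\<forall>z. 1 - v z * g z = (\<Prod>k<n. z - a k) * w z)"
    using entire_interpolation[OF a(2) g] by blast
  define p where "p z = 1 - v z * g z" for z
  \<comment> \<open>Comparing orders presupposes a nonzero function, so the case
    \<open>v g = 1\<close> is separate.\<close>
  show ?thesis
  proof (cases "p = (\<lambda>_. 0)")
    case True
    then have "1 - v z * g z = 0" for z
      unfolding p_def by meson
    then have "v z * g z = 1" for z
      by simp
    then show ?thesis
      using that[of "\<lambda>_. 0" v] v by auto
  next
    case False
    have p: "p holomorphic_on UNIV"
      unfolding p_def by (intro holomorphic_intros v g)
    have "zorder f z \<le> zorder p z" for z
    proof (cases "f z = 0")
      case False
      then show ?thesis
        using zorder_entire_eq_0_iff[OF f(1,2), of z] zorder_entire_nonneg[OF p \<open>p \<noteq> _\<close>, of z] by simp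
    next
      case True
      then have z: "finite (a -` {z})" "card (a -` {z}) = c z"
        using a(3) by auto
      \<comment> \<open>Take \<open>n\<close> beyond every index at which the node \<open>z\<close>
        occurs: the product of the first \<open>n\<close> linear factors then has exactly the order
        of \<open>f\<close> at \<open>z\<close>.\<close>
      then obtain n where n: "a -` {z} \<subseteq> {..<n}"
        using finite_nat_iff_bounded by blast
      obtain w where "w holomorphic_on UNIV" "\<forall>z. 1 - v z * g z = (\<Prod>k<n. z - a k) * w z"
        using v(2)[of n] by blast
      then have w: "w holomorphic_on UNIV" "p = (\<lambda>z. (\<Prod>k<n. z - a k) * w z)"
        by (simp_all add: p_def fun_eq_iff)
      let ?q = "\<lambda>z. \<Prod>k<n. z - a k"
      have nz: "?q \<noteq> (\<lambda>_. 0)" "w \<noteq> (\<lambda>_. 0)"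
        using False w(2) by (auto simp: fun_eq_iff)
      have q: "?q holomorphic_on UNIV"
        by (intro holomorphic_intros)
      have "zorder ?q z = (\<Sum>k<n. if a k = z then 1 else 0)"
        using zorder_prod_linear_powers[of "{..<n}" a "\<lambda>_. 1" z] by (simp cong: if_cong)
      also have "\<dots> = int (card ({..<n} \<inter> {k. a k = z}))"
        by (simp add: sum.If_cases)
      also have "{..<n} \<inter> {k. a k = z} = a -` {z}"
        using n by auto
      finally have "zorder ?q z = zorder f z"
        by (simp add: z c)
      then show ?thesis
        using zorder_entire_mult[OF q nz(1) w(1) nz(2), of z] zorder_entire_nonneg[OF w(1) nz(2), of z]
        by (simp add: w(2))
    qed
    then obtain u where "u holomorphic_on UNIV" "\<And>z. p z = f z * u z"
      using entire_dvd_of_zorder_le[OF f(1,2) p False] by blast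
    then show ?thesis
      using that[of u v] v(1) by (simp add: p_def algebra_simps)
  qed
qed

section \<open>Maximal ideals that are not finitely generated\<close>

lemma entire_ring_simps [simp]:
  "f \<in> carrier entire_ring \<longleftrightarrow> f holomorphic_on UNIV"
  "f \<otimes>\<^bsub>entire_ring\<^esub> g = (\<lambda>z. f z * g z)"
  "f \<oplus>\<^bsub>entire_ring\<^esub> g = (\<lambda>z. f z + g z)"
  "\<one>\<^bsub>entire_ring\<^esub> = (\<lambda>_. 1)"
  "\<zero>\<^bsub>entire_ring\<^esub> = (\<lambda>_. 0)"
  by (simp_all add: entire_ring_def)

lemma entire_ring_pow: "f [^]\<^bsub>entire_ring\<^esub> (n::nat) = (\<lambda>z. f z ^ n)"
proof (induction n)
  case 0
  then show ?case
    by (simp add: nat_pow_def)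
next
  case (Suc n)
  then show ?case
    by (simp add: nat_pow_def mult.commute)
qed

lemma domain_entire_ring: "domain entire_ring"
proof -
  interpret cring entire_ring
    by (rule cring_entire_ring)
  show ?thesis
  proof
    show "\<one>\<^bsub>entire_ring\<^esub> \<noteq> \<zero>\<^bsub>entire_ring\<^esub>"
      by (simp add: fun_eq_iff)
    show "f = \<zero>\<^bsub>entire_ring\<^esub> \<or> g = \<zero>\<^bsub>entire_ring\<^esub>"
      if "f \<otimes>\<^bsub>entire_ring\<^esub> g = \<zero>\<^bsub>entire_ring\<^esub>" "f \<in> carrier entire_ring" "g \<in> carrier entire_ring"
      for f g
      using that entire_mult_nonzero[of f g] by auto
  qed
qed

locale non_fin_gen_maximalideal = maximalideal M entire_ring for M +
  assumes not_fin_gen: "\<not> fin_gen_ideal entire_ring M"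
begin

sublocale domain entire_ring
  by (rule domain_entire_ring)

sublocale primeideal M entire_ring
  using maximalideal_prime[OF maximalideal_axioms] .

sublocale mult_subset entire_ring "carrier entire_ring - M"
  by (rule mult_subset_compl_primeideal) (rule primeideal_axioms)

lemma mem_holomorphic: "f \<in> M \<Longrightarrow> f holomorphic_on UNIV"
  using Icarr by simp

lemma mem_mult: "\<lbrakk>f \<in> M; g holomorphic_on UNIV\<rbrakk> \<Longrightarrow> (\<lambda>z. f z * g z) \<in> M"
  using I_r_closed[of f g] by simp

lemma mem_add: "\<lbrakk>f \<in> M; g \<in> M\<rbrakk> \<Longrightarrow> (\<lambda>z. f z + g z) \<in> M"
  using additive_subgroup.a_closed[OF is_additive_subgroup, of f g] by simp

lemma mem_mult_cases:
  "\<lbrakk>f holomorphic_on UNIV; g holomorphic_on UNIV; (\<lambda>z. f z * g z) \<in> M\<rbrakk> \<Longrightarrow> f \<in> M \<or> g \<in> M"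
  using I_prime[of f g] by simp

text \<open>Such a function is a unit.\<close>

lemma nonvanishing_notin:
  assumes "f holomorphic_on UNIV" "\<And>z. f z \<noteq> 0"
  shows "f \<notin> M"
proof
  assume "f \<in> M"
  then have "(\<lambda>z. f z * (1 / f z)) \<in> M"
    using assms by (intro mem_mult holomorphic_intros) auto
  then have "\<one>\<^bsub>entire_ring\<^esub> \<in> M"
    using assms(2) by simp
  then show False
    using one_imp_carrier I_notcarr by blast
qed

text \<open>If \<open>z - a\<close> were in \<open>M\<close>, then for each \<open>f\<close> in
  \<open>M\<close> the constant \<open>f a\<close> would be in \<open>M\<close>, hence zero. Every
  such \<open>f\<close> would be a multiple of \<open>z - a\<close>, making \<open>M\<close>
  principal.\<close>

lemma linear_notin: "(\<lambda>z. z - a) \<notin> M"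
proof
  let ?l = "\<lambda>z. z - a"
  assume l: "?l \<in> M"
  have "f \<in> Idl\<^bsub>entire_ring\<^esub> {?l}" if f: "f \<in> M" for f
  proof -
    have "(\<lambda>z. f z - f a) holomorphic_on UNIV"
      using mem_holomorphic[OF f] by (intro holomorphic_intros)
    then obtain k where k: "k holomorphic_on UNIV" "\<And>z. f z - f a = (z - a) * k z"
      by (rule entire_divide_linear) auto
    have "(\<lambda>z. ?l z * (- k z)) \<in> M"
      using k(1) by (intro mem_mult[OF l] holomorphic_intros)
    then have "(\<lambda>z. f z + ?l z * (- k z)) \<in> M"
      by (rule mem_add[OF f])
    moreover have "f z + ?l z * (- k z) = f a" for z
      using k(2)[of z] by (simp add: algebra_simps)
    ultimately have "(\<lambda>_. f a) \<in> M"
      by simp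
    then have "f a = 0"
      using nonvanishing_notin[of "\<lambda>_. f a"] by auto
    then have "f = (\<lambda>z. k z * ?l z)"
      using k(2) by (simp add: fun_eq_iff mult.commute)
    moreover have "(\<lambda>z. k z * ?l z) \<in> Idl\<^bsub>entire_ring\<^esub> {?l}"
      using ideal.I_l_closed[OF genideal_ideal[of "{?l}"], of ?l k] genideal_self'[of ?l] k(1) mem_holomorphic[OF l]
      by simp
    ultimately show ?thesis
      by simp
  qed
  moreover have "Idl\<^bsub>entire_ring\<^esub> {?l} \<subseteq> M"
    using l by (intro genideal_minimal is_ideal) auto
  ultimately have "M = Idl\<^bsub>entire_ring\<^esub> {?l}"
    by blast
  then show False
    using not_fin_gen mem_holomorphic[OF l] unfolding fin_gen_ideal_def
    by (metis empty_subsetI entire_ring_simps(1) finite.emptyI finite_insert insert_subset)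
qed

lemma linear_power_notin: "(\<lambda>z. (z - a) ^ n) \<notin> M"
proof (induction n)
  case 0
  show ?case
    by (rule nonvanishing_notin) auto
next
  case (Suc n)
  show ?case
  proof
    assume "(\<lambda>z. (z - a) ^ Suc n) \<in> M"
    then have "(\<lambda>z. (z - a) * (z - a) ^ n) \<in> M"
      by simp
    then have "(\<lambda>z. z - a) \<in> M \<or> (\<lambda>z. (z - a) ^ n) \<in> M"
      by (intro mem_mult_cases holomorphic_intros)
    then show False
      using linear_notin Suc.IH by blast
  qed
qed

lemma prod_linear_powers_notin:
  assumes "finite A"
  shows "(\<lambda>z. \<Prod>a\<in>A. (z - a) ^ c a) \<notin> M"
  using assms
proof induction
  case empty
  show ?case
    by (rule nonvanishing_notin) auto
next
  case (insert a A)
  show ?case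
  proof
    assume "(\<lambda>z. \<Prod>a\<in>insert a A. (z - a) ^ c a) \<in> M"
    then have "(\<lambda>z. (z - a) ^ c a * (\<Prod>a\<in>A. (z - a) ^ c a)) \<in> M"
      using insert.hyps by simp
    then have "(\<lambda>z. (z - a) ^ c a) \<in> M \<or> (\<lambda>z. \<Prod>a\<in>A. (z - a) ^ c a) \<in> M"
      by (intro mem_mult_cases holomorphic_intros)
    then show False
      using linear_power_notin insert.IH by blast
  qed
qed

text \<open>Such an \<open>f\<close> is a polynomial with the same orders times a nowhere vanishing
  function, and neither factor lies in the prime ideal \<open>M\<close>.\<close>

lemma finite_zeros_notin:
  assumes f: "f holomorphic_on UNIV" "f \<noteq> (\<lambda>_. 0)" and fin: "finite {z. f z = 0}"
  shows "f \<notin> M"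
proof
  assume "f \<in> M"
  let ?q = "\<lambda>z. \<Prod>a\<in>{z. f z = 0}. (z - a) ^ nat (zorder f a)"
  have q: "?q holomorphic_on UNIV"
    by (intro holomorphic_intros)
  have qM: "?q \<notin> M"
    by (rule prod_linear_powers_notin[OF fin])
  \<comment> \<open>The zero function lies in \<open>M\<close>, but \<open>?q\<close> does
    not.\<close>
  have q0: "?q \<noteq> (\<lambda>_. 0)"
  proof
    assume q0: "?q = (\<lambda>_. 0)"
    have "?q \<in> M"
      unfolding q0 using additive_subgroup.zero_closed[OF is_additive_subgroup] by simp
    then show False
      using qM by contradiction
  qed
  have ord: "zorder ?q z = zorder f z" for z
    using zorder_entire_nonneg[OF f, of z] zorder_entire_eq_0_iff[OF f, of z]
    unfolding zorder_prod_distinct_linear_powers[OF fin] by auto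
  obtain k where k: "k holomorphic_on UNIV" "k \<noteq> (\<lambda>_. 0)" "\<And>z. f z = ?q z * k z"
    using entire_dvd_of_zorder_le[OF q q0 f] ord by (metis order_refl)
  then have fk: "f = (\<lambda>z. ?q z * k z)"
    by (intro ext)
  have "k z \<noteq> 0" for z
  proof -
    have "zorder f z = zorder ?q z + zorder k z"
      by (subst (1) fk) (rule zorder_entire_mult[OF q q0 k(1,2)])
    then show ?thesis
      using ord[of z] zorder_entire_eq_0_iff[OF k(1,2), of z] by simp
  qed
  then have "k \<notin> M"
    by (rule nonvanishing_notin[OF k(1)])
  moreover have "(\<lambda>z. ?q z * k z) \<in> M"
    using \<open>f \<in> M\<close> fk by simp
  ultimately show False
    using mem_mult_cases[OF q k(1)] qM by blast
qed

section \<open>Divisibility in the localization at \<open>M\<close>\<close>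

abbreviation "L \<equiv> ring_of_fractions entire_ring (carrier entire_ring - M)"

lemma zero_notin_compl: "\<zero>\<^bsub>entire_ring\<^esub> \<notin> carrier entire_ring - M"
  using additive_subgroup.zero_closed[OF is_additive_subgroup] by blast

sublocale L: domain L
  by (rule domain_fractions[OF domain_entire_ring zero_notin_compl])

text \<open>Writing the numerators as \<open>d f'\<close> and \<open>d g'\<close> gives
  \<open>f' g = g' f\<close>. The coprime cofactors cannot both lie in \<open>M\<close>, and one
  outside \<open>M\<close> becomes invertible.\<close>

lemma divides_total:
  assumes "x \<in> carrier L" "y \<in> carrier L"
  shows "x divides\<^bsub>L\<^esub> y \<or> y divides\<^bsub>L\<^esub> x"
proof -
  let ?S = "carrier entire_ring - M"
  obtain f s where x: "x = fraction entire_ring ?S f s" and f: "f \<in> carrier entire_ring" and s: "s \<in> ?S"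
    using assms(1) unfolding carrier_fractions by blast
  obtain g t where y: "y = fraction entire_ring ?S g t" and g: "g \<in> carrier entire_ring" and t: "t \<in> ?S"
    using assms(2) unfolding carrier_fractions by blast
  have "\<exists>u v. u \<in> carrier entire_ring \<and> v \<in> carrier entire_ring \<and> (u \<notin> M \<or> v \<notin> M) \<and>
      u \<otimes>\<^bsub>entire_ring\<^esub> g = v \<otimes>\<^bsub>entire_ring\<^esub> f"
  \<comment> \<open>\<open>entire_gcd\<close> applies to nonzero functions; a zero numerator is
    divisible by anything.\<close>
  proof (cases "f = (\<lambda>_. 0) \<or> g = (\<lambda>_. 0)")
    case True
    have one: "(\<lambda>_. 1) \<notin> M"
      by (rule nonvanishing_notin) auto
    show ?thesis
    proof (cases "f = (\<lambda>_. 0)")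
      case True
      show ?thesis
        by (rule exI[of _ "\<lambda>_. 0"], rule exI[of _ "\<lambda>_. 1"]) (use True one in simp)
    next
      case False
      then have "g = (\<lambda>_. 0)"
        using \<open>f = _ \<or> g = _\<close> by blast
      then show ?thesis
        by (intro exI[of _ "\<lambda>_. 1"] exI[of _ "\<lambda>_. 0"]) (use one in simp)
    qed
  next
    case False
    then have f0: "f holomorphic_on UNIV" "f \<noteq> (\<lambda>_. 0)" and g0: "g holomorphic_on UNIV" "g \<noteq> (\<lambda>_. 0)"
      using f g by auto
    obtain d f' g' where d: "d holomorphic_on UNIV"
      and f': "f' holomorphic_on UNIV" "f' \<noteq> (\<lambda>_. 0)" and g': "g' holomorphic_on UNIV"
      and fg: "\<And>z. f z = d z * f' z" "\<And>z. g z = d z * g' z" and coprime: "\<And>z. f' z \<noteq> 0 \<or> g' z \<noteq> 0"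
      by (rule entire_gcd[OF f0 g0]) blast
    have "f' \<notin> M \<or> g' \<notin> M"
    proof (rule ccontr)
      assume "\<not> (f' \<notin> M \<or> g' \<notin> M)"
      then have M: "f' \<in> M" "g' \<in> M"
        by auto
      \<comment> \<open>Membership in \<open>M\<close> supplies the infinitely many zeros that
        \<open>entire_bezout\<close> asks for.\<close>
      have "infinite {z. f' z = 0}"
        using finite_zeros_notin[OF f'] M(1) by blast
      then obtain u v where uv: "u holomorphic_on UNIV" "v holomorphic_on UNIV" "\<And>z. u z * f' z + v z * g' z = 1"
        using entire_bezout[OF f' _ g' coprime] by blast
      have "(\<lambda>z. f' z * u z + g' z * v z) \<in> M"
        using M uv by (intro mem_add mem_mult)
      then have "(\<lambda>_. 1) \<in> M"
        using uv(3) by (simp add: mult.commute)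
      then show False
        using nonvanishing_notin[of "\<lambda>_. 1"] by auto
    qed
    then show ?thesis
      using f' g' by (intro exI[of _ f'] exI[of _ g']) (simp add: fg fun_eq_iff)
  qed
  then obtain u v where uv: "u \<in> carrier entire_ring" "v \<in> carrier entire_ring" "u \<notin> M \<or> v \<notin> M"
    "u \<otimes>\<^bsub>entire_ring\<^esub> g = v \<otimes>\<^bsub>entire_ring\<^esub> f"
    by blast
  then show ?thesis
  proof (elim disjE)
    assume "u \<notin> M"
    then have "x divides\<^bsub>L\<^esub> y"
      unfolding x y using uv f g s t by (intro fraction_dividesI[of f s g t u v]) auto
    then show ?thesis ..
  next
    assume "v \<notin> M"
    then have "y divides\<^bsub>L\<^esub> x"
      unfolding x y using uv f g s t by (intro fraction_dividesI[of g t f s v u]) auto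
    then show ?thesis ..
  qed
qed

text \<open>The zero ideal is finitely generated.\<close>

lemma ex_nonzero_mem: "\<exists>b\<in>M. b \<noteq> (\<lambda>_. 0)"
proof (rule ccontr)
  assume "\<not> (\<exists>b\<in>M. b \<noteq> (\<lambda>_. 0))"
  then have "M \<subseteq> {\<zero>\<^bsub>entire_ring\<^esub>}"
    unfolding entire_ring_simps by blast
  moreover have "\<zero>\<^bsub>entire_ring\<^esub> \<in> M"
    by (rule additive_subgroup.zero_closed[OF is_additive_subgroup])
  ultimately have "M = {\<zero>\<^bsub>entire_ring\<^esub>}"
    by blast
  also have "\<dots> = Idl\<^bsub>entire_ring\<^esub> {\<zero>\<^bsub>entire_ring\<^esub>}"
    by (rule genideal_zero[symmetric])
  finally have "\<exists>A\<subseteq>carrier entire_ring. finite A \<and> M = Idl\<^bsub>entire_ring\<^esub> A"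
    using zero_closed by (intro exI[of _ "{\<zero>\<^bsub>entire_ring\<^esub>}"]) simp
  then show False
    using not_fin_gen unfolding fin_gen_ideal_def by contradiction
qed

text \<open>The order of \<open>g\<close> falls short of that of \<open>b ^ n\<close> only at zeros
  of \<open>b\<close> of norm below \<open>n\<close>. These are finitely many, so a function
  \<open>s\<close> with finitely many zeros makes up the difference, and such an \<open>s\<close> is
  outside \<open>M\<close>.\<close>

lemma ex_multiple_of_all_powers:
  assumes b: "b holomorphic_on UNIV" "b \<noteq> (\<lambda>_. 0)"
  shows "\<exists>g. g holomorphic_on UNIV \<and> g \<noteq> (\<lambda>_. 0) \<and>
    (\<forall>n. \<exists>s k. s holomorphic_on UNIV \<and> s \<notin> M \<and> k holomorphic_on UNIV \<and> (\<forall>z. s z * g z = k z * b z ^ n))"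
proof -
  have zero: "b z = 0" if "zorder b z > 0" for z
    using zorder_entire_eq_0_iff[OF b, of z] that by auto
  define c where "c z = nat \<lfloor>norm z\<rfloor> * nat (zorder b z)" for z
  have "{z. c z > 0} \<subseteq> {z. b z = 0}"
    using zero by (auto simp: c_def)
  then have "finite ({z. c z > 0} \<inter> cball 0 r)" for r
    using finite_subset[OF _ finite_zeros_cball[OF b, of 0 r]] by blast
  then obtain g where g: "g holomorphic_on UNIV" "g \<noteq> (\<lambda>_. 0)" "\<And>z. zorder g z = int (c z)"
    using entire_with_orders by blast
  have "\<exists>s k. s holomorphic_on UNIV \<and> s \<notin> M \<and> k holomorphic_on UNIV \<and> (\<forall>z. s z * g z = k z * b z ^ n)"
    for n
  proof -
    \<comment> \<open>The deficit of \<open>g\<close> against \<open>b ^ n\<close>; truncated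
      subtraction makes it 0 where the order of \<open>g\<close> suffices.\<close>
    define e where "e z = n * nat (zorder b z) - c z" for z
    have "{z. e z > 0} \<subseteq> {z. b z = 0} \<inter> cball 0 (real n)"
    proof
      fix z assume "z \<in> {z. e z > 0}"
      then have *: "nat \<lfloor>norm z\<rfloor> * nat (zorder b z) < n * nat (zorder b z)"
        by (simp add: e_def c_def)
      then have "zorder b z > 0" "nat \<lfloor>norm z\<rfloor> < n"
        by (auto intro: ccontr)
      then have "norm z \<le> real n"
        by linarith
      then show "z \<in> {z. b z = 0} \<inter> cball 0 (real n)"
        using zero[OF \<open>zorder b z > 0\<close>] by simp
    qed
    then have fin: "finite {z. e z > 0}"
      using finite_subset finite_zeros_cball[OF b] by blast
    then obtain s where s: "s holomorphic_on UNIV" "s \<noteq> (\<lambda>_. 0)" "\<And>z. zorder s z = int (e z)"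
      using entire_with_orders[of e] by blast
    have "{z. s z = 0} \<subseteq> {z. e z > 0}"
      using zorder_entire_eq_0_iff[OF s(1,2)] s(3) by (auto intro: ccontr)
    then have "finite {z. s z = 0}"
      using fin finite_subset by blast
    then have sM: "s \<notin> M"
      by (rule finite_zeros_notin[OF s(1,2)])
    have bn: "(\<lambda>z. b z ^ n) holomorphic_on UNIV" "(\<lambda>z. b z ^ n) \<noteq> (\<lambda>_. 0)"
      using b by (auto simp: fun_eq_iff intro!: holomorphic_intros)
    have sg: "(\<lambda>z. s z * g z) holomorphic_on UNIV" "(\<lambda>z. s z * g z) \<noteq> (\<lambda>_. 0)"
      using s(1,2) g(1,2) entire_mult_nonzero by (auto intro: holomorphic_intros)
    have "zorder (\<lambda>z. b z ^ n) z \<le> zorder (\<lambda>z. s z * g z) z" for z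
    proof -
      have "n * nat (zorder b z) \<le> e z + c z"
        unfolding e_def by arith
      then have "int (n * nat (zorder b z)) \<le> int (e z) + int (c z)"
        unfolding of_nat_add[symmetric] of_nat_le_iff .
      then have "int n * zorder b z \<le> int (e z) + int (c z)"
        using zorder_entire_nonneg[OF b, of z] by simp
      then show ?thesis
        unfolding zorder_entire_power[OF b] zorder_entire_mult[OF s(1,2) g(1,2)] s(3) g(3) .
    qed
    then obtain k where "k holomorphic_on UNIV" "\<And>z. s z * g z = b z ^ n * k z"
      using entire_dvd_of_zorder_le[OF bn sg] by blast
    then show ?thesis
      using s(1) sM by (intro exI[of _ s] exI[of _ k]) (simp add: mult.commute)
  qed
  then show ?thesis
    using g by blast
qed

text \<open>A nonzero \<open>b\<close> in \<open>M\<close> gives a nonunit \<open>b / 1\<close>. In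
  \<open>s g = k b ^ n\<close> the factor \<open>s\<close> is an admissible denominator, so every
  power of \<open>b / 1\<close> divides \<open>g / 1\<close>.\<close>

lemma not_BL: "\<not> BL_ring L"
proof -
  let ?S = "carrier entire_ring - M"
  obtain b where b: "b \<in> M" "b \<noteq> (\<lambda>_. 0)"
    using ex_nonzero_mem by blast
  note b_hol = mem_holomorphic[OF b(1)]
  obtain g where g: "g holomorphic_on UNIV" "g \<noteq> (\<lambda>_. 0)"
    and dvd: "\<And>n. \<exists>s k. s holomorphic_on UNIV \<and> s \<notin> M \<and> k holomorphic_on UNIV \<and> (\<forall>z. s z * g z = k z * b z ^ n)"
    using ex_multiple_of_all_powers[OF b_hol b(2)] by blast
  let ?b = "fraction entire_ring ?S b \<one>\<^bsub>entire_ring\<^esub>" and ?g = "fraction entire_ring ?S g \<one>\<^bsub>entire_ring\<^esub>"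
  show ?thesis
  proof (rule L.not_BL_ring_if_power_divides[of ?b ?g, OF divides_total])
    show "?b \<in> carrier L" "?g \<in> carrier L"
      using b_hol g S_one by (auto intro!: fraction_in_carrier simp del: entire_ring_simps(4))
    show "?b \<notin> Units L"
      using fraction_not_unit[OF primeideal_axioms b(1) S_one] by (simp add: localization_at_def)
    show "?g \<noteq> \<zero>\<^bsub>L\<^esub>"
      using fraction_eq_zero_iff[OF domain_entire_ring zero_notin_compl _ S_one, of g] g by simp
    fix n :: nat
    obtain s k where sk: "s holomorphic_on UNIV" "s \<notin> M" "k holomorphic_on UNIV" "\<forall>z. s z * g z = k z * b z ^ n"
      using dvd by blast
    have "?b [^]\<^bsub>L\<^esub> n = fraction entire_ring ?S (\<lambda>z. b z ^ n) \<one>\<^bsub>entire_ring\<^esub>"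
      using fraction_pow[of b n] b_hol by (simp add: entire_ring_pow)
    also have "\<dots> divides\<^bsub>L\<^esub> ?g"
      using sk b_hol g S_one
      by (intro fraction_dividesI[of _ _ _ _ s k]) (auto intro!: holomorphic_intros)
    finally show "(?b [^]\<^bsub>L\<^esub> n) divides\<^bsub>L\<^esub> ?g" .
  qed
qed

end

theorem theorem5p24:
  fixes M :: "(complex \<Rightarrow> complex) set"
  assumes "maximalideal M entire_ring"
    and "\<not> fin_gen_ideal entire_ring M"
  shows "MTL_ring (localization_at entire_ring M) \<and> \<not> BL_ring (localization_at entire_ring M)"
proof -
  interpret non_fin_gen_maximalideal M
    using assms by (simp add: non_fin_gen_maximalideal_def non_fin_gen_maximalideal_axioms_def)
  show ?thesis
    unfolding localization_at_def
    using L.MTL_ring_if_divides_total[OF divides_total] not_BL by blast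
qed

end
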